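(* Let $k\ge 1$, let $W_2=\mathbb{C}\langle\sigma_1,\dots,\sigma_k,\partial_1,\dots,\partial_k\rangle$ act on $\mathcal{M}=\mathbb{C}[\sigma][\Delta^{-1}]\,\delta$ as described in the context. Let $\mathcal{J}=\{Q\in W_2: Q(\delta)=0 \text{ in } \mathbb{C}[\sigma][\Delta^{-1}]\delta\}$ be the annihilator of $\delta$ in $W_2$, and let $\mathcal{I}$ be the annihilator of $\delta$ in $W_1^{\mathfrak{S}_k}$. Then $\mathcal{J}=[\Delta^{-1}]\mathcal{I}\cap W_2$, and $\mathcal{J}$ is a maximal left ideal of $W_2$. Consequently the left $W_2$-submodule $\mathcal{M}_0=W_2\,\delta$ of $\mathcal{M}$ generated by $\delta$ is simple.
   Context: $W_1$ is the Weyl algebra in $z_1,\dots,z_k$; $W_1^{\mathfrak{S}_k}$ is its subalgebra of elements invariant under simultaneous permutations of the $z_j$ and the $\partial/\partial z_j$. $\sigma_1,\dots,\sigma_k$ are the elementary symmetric functions of $z_1,\dots,z_k$, $\mathbb{C}[\sigma]=\mathbb{C}[\sigma_1,\dots,\sigma_k]=\mathbb{C}[z_1,\dots,z_k]^{\mathfrak{S}_k}$, $\partial_i=\partial/\partial\sigma_i$, and $W_2$ is the Weyl algebra in the variables $\sigma_1,\dots,\sigma_k$. $\delta=\prod_{1\le i<j\le k}(z_i-z_j)$ and $\Delta=\delta^2\in\mathbb{C}[\sigma]$. The algebra $W_1^{\mathfrak{S}_k}$ is regarded as a subalgebra of $W_2$ via the injective morphism given by its action on $\mathbb{C}[\sigma]$.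 $\mathcal{M}=\mathbb{C}[\sigma][\Delta^{-1}]\delta$ is the free rank one $\mathbb{C}[\sigma][\Delta^{-1}]$-module with basis $\delta$, made into a left $W_2$-module by $\partial_i(f\delta)=\big(\partial_i f+f\,\frac{\partial_i\Delta}{2\Delta}\big)\delta$ for $f\in\mathbb{C}[\sigma][\Delta^{-1}]$, $i\in[1,k]$. Restricted to $W_1^{\mathfrak{S}_k}$ and to $\mathbb{C}[\sigma]\delta$, this is the usual action of differential operators on antisymmetric polynomials in $z_1,\dots,z_k$. $[\Delta^{-1}]W_2=\bigcup_{m\ge0}\Delta^{-m}W_2=\mathbb{C}[\sigma][\Delta^{-1}]\otimes_{\mathbb{C}[\sigma]}W_2$ is the localized algebra, $\mathcal{I}=\{P\in W_1^{\mathfrak{S}_k}:P(\delta)=0\}$, and $[\Delta^{-1}]\mathcal{I}=\bigcup_{m\ge 0}\Delta^{-m}\mathcal{I}\subset[\Delta^{-1}]W_2$. *)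

theory Defs
  imports
    "HOL-Library.Poly_Mapping"
    "HOL-Computational_Algebra.Polynomial_Factorial"
    "HOL-Algebra.Generated_Rings"
    "HOL-Algebra.RingHom"
begin

section \<open>Left ideals and left submodules\<close>

definition left_ideal :: "'a set \<Rightarrow> ('a, 'm) ring_scheme \<Rightarrow> bool" where
  "left_ideal J R \<longleftrightarrow>
     additive_subgroup J R \<and> (\<forall>a\<in>carrier R. \<forall>x\<in>J. a \<otimes>\<^bsub>R\<^esub> x \<in> J)"

definition maximal_left_ideal :: "'a set \<Rightarrow> ('a, 'm) ring_scheme \<Rightarrow> bool" where
  "maximal_left_ideal J R \<longleftrightarrow>
     left_ideal J R \<and> J \<noteq> carrier R \<and>
     (\<forall>L. left_ideal L R \<longrightarrow> J \<subseteq> L \<longrightarrow> L = J \<or> L = carrier R)"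

text \<open>\<open>act\<close> is the action of \<open>R\<close> on an ambient module that is a whole type.\<close>

definition left_submodule ::
    "('r, 'm) ring_scheme \<Rightarrow> ('r \<Rightarrow> 'a \<Rightarrow> 'a) \<Rightarrow> 'a::ab_group_add set \<Rightarrow> bool" where
  "left_submodule R act N \<longleftrightarrow>
     0 \<in> N \<and> (\<forall>x\<in>N. \<forall>y\<in>N. x - y \<in> N) \<and> (\<forall>a\<in>carrier R. \<forall>x\<in>N. act a x \<in> N)"

definition simple_left_submodule ::
    "('r, 'm) ring_scheme \<Rightarrow> ('r \<Rightarrow> 'a \<Rightarrow> 'a) \<Rightarrow> 'a::ab_group_add set \<Rightarrow> bool" where
  "simple_left_submodule R act N \<longleftrightarrow>
     left_submodule R act N \<and> N \<noteq> {0} \<and>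
     (\<forall>N'. left_submodule R act N' \<longrightarrow> N' \<subseteq> N \<longrightarrow> N' = {0} \<or> N' = N)"

definition End_ring :: "('a::ab_group_add \<Rightarrow> 'a) ring" where
  "End_ring = \<lparr>carrier = {T. \<forall>f g. T (f + g) = T f + T g}, mult = (\<circ>), one = id,
     zero = (\<lambda>_. 0), add = (\<lambda>S T f. S f + T f)\<rparr>"

lemma End_ring_simps [simp]:
  "carrier End_ring = {T. \<forall>f g. T (f + g) = T f + T g}"
  "mult End_ring = (\<circ>)" "one End_ring = id" "zero End_ring = (\<lambda>_. 0)"
  "add End_ring = (\<lambda>S T f. S f + T f)"
  by (simp_all add: End_ring_def)

lemma ring_End_ring: "ring (End_ring :: ('a::ab_group_add \<Rightarrow> 'a) ring)"
proof (rule ringI)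
  show "abelian_group (End_ring :: ('a \<Rightarrow> 'a) ring)"
  proof (rule abelian_groupI)
    fix S :: "'a \<Rightarrow> 'a" assume "S \<in> carrier End_ring"
    then show "\<exists>T\<in>carrier End_ring. T \<oplus>\<^bsub>End_ring\<^esub> S = \<zero>\<^bsub>End_ring\<^esub>"
      by (intro bexI[of _ "\<lambda>f. - S f"]) auto
  qed (auto simp: algebra_simps)
  show "monoid (End_ring :: ('a \<Rightarrow> 'a) ring)"
    by unfold_locales (auto simp: o_assoc)
qed (auto simp: fun_eq_iff)

lemma a_inv_End_ring:
  assumes "S \<in> carrier (End_ring :: ('a::ab_group_add \<Rightarrow> 'a) ring)"
  shows "\<ominus>\<^bsub>End_ring\<^esub> S = (\<lambda>f. - S f)"
proof -
  interpret E: ring "End_ring :: ('a \<Rightarrow> 'a) ring" by (rule ring_End_ring)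
  show ?thesis
    by (rule E.minus_equality) (use assms in auto)
qed


section \<open>Polynomials and rational functions\<close>

text \<open>
  The variables are indexed by a finite linearly ordered type \<open>'n\<close>; the number \<open>k\<close> of
  variables is \<open>CARD('n)\<close>, and the index type corresponds to \<open>{1..k}\<close> through \<open>rank\<close> below.
  The same type \<open>'n mpoly\<close> serves for polynomials in the \<open>z\<^sub>i\<close> and for polynomials in the
  \<open>\<sigma>\<^sub>i\<close>; these are related by \<open>esym_subst\<close>.
\<close>

type_synonym 'n mpoly = "('n \<Rightarrow>\<^sub>0 nat) \<Rightarrow>\<^sub>0 complex"
type_synonym 'n ratfun = "'n mpoly fract"

definition Const :: "complex \<Rightarrow> 'n mpoly" where
  "Const c = Poly_Mapping.single 0 c"

definition X :: "'n \<Rightarrow> 'n mpoly" where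
  "X i = Poly_Mapping.single (Poly_Mapping.single i 1) 1"

definition subst :: "('n \<Rightarrow> 'm mpoly) \<Rightarrow> 'n::finite mpoly \<Rightarrow> 'm mpoly" where
  "subst g p = (\<Sum>a\<in>Poly_Mapping.keys p.
     Const (Poly_Mapping.lookup p a) * (\<Prod>i\<in>UNIV. g i ^ Poly_Mapping.lookup a i))"

definition pdiff :: "'n \<Rightarrow> 'n mpoly \<Rightarrow> 'n mpoly" where
  "pdiff i p = (\<Sum>a\<in>Poly_Mapping.keys p.
     Poly_Mapping.single (a - Poly_Mapping.single i 1)
       (of_nat (Poly_Mapping.lookup a i) * Poly_Mapping.lookup p a))"

lemma sum_keys_superset:
  assumes "finite A" "Poly_Mapping.keys p \<subseteq> A" "\<And>a. F a 0 = 0"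
  shows "(\<Sum>a\<in>Poly_Mapping.keys p. F a (Poly_Mapping.lookup p a)) =
    (\<Sum>a\<in>A. F a (Poly_Mapping.lookup p a))"
  by (rule sum.mono_neutral_left) (use assms in \<open>auto simp: in_keys_iff\<close>)

lemma pdiff_superset:
  assumes "finite A" "Poly_Mapping.keys p \<subseteq> A"
  shows "pdiff i p = (\<Sum>a\<in>A. Poly_Mapping.single (a - Poly_Mapping.single i 1)
       (of_nat (Poly_Mapping.lookup a i) * Poly_Mapping.lookup p a))"
  unfolding pdiff_def
  by (rule sum_keys_superset[where F = "\<lambda>a c. Poly_Mapping.single (a - Poly_Mapping.single i 1)
       (of_nat (Poly_Mapping.lookup a i) * c)"]) (use assms in auto)

lemma pdiff_0 [simp]: "pdiff i 0 = 0"
  by (simp add: pdiff_def)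

lemma pdiff_add: "pdiff i (p + q) = pdiff i p + pdiff i q"
proof -
  define A where "A = Poly_Mapping.keys p \<union> Poly_Mapping.keys q"
  have A: "finite A" "Poly_Mapping.keys p \<subseteq> A" "Poly_Mapping.keys q \<subseteq> A"
    "Poly_Mapping.keys (p + q) \<subseteq> A"
    using Poly_Mapping.keys_add[of p q] by (auto simp: A_def)
  show ?thesis
    using A by (simp add: pdiff_superset[of A] lookup_add ring_distribs single_add sum.distrib)
qed

lemma pdiff_sum: "pdiff i (sum f A) = (\<Sum>a\<in>A. pdiff i (f a))"
  by (induction A rule: infinite_finite_induct) (auto simp: pdiff_add)

lemma pdiff_single:
  "pdiff i (Poly_Mapping.single a c) =
     Poly_Mapping.single (a - Poly_Mapping.single i 1) (of_nat (Poly_Mapping.lookup a i) * c)"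
  by (subst pdiff_superset[of "{a}"]) auto

lemma mpoly_as_sum:
  "p = (\<Sum>a\<in>Poly_Mapping.keys p. Poly_Mapping.single a (Poly_Mapping.lookup p a))"
  by (rule poly_mapping_eqI)
     (auto simp: lookup_sum lookup_single when_def in_keys_iff)

lemma pdiff_mult_single:
  "pdiff i (Poly_Mapping.single a c * Poly_Mapping.single b d) =
     pdiff i (Poly_Mapping.single a c) * Poly_Mapping.single b d +
     Poly_Mapping.single a c * pdiff i (Poly_Mapping.single b d)"
proof -
  define e :: "'a \<Rightarrow>\<^sub>0 nat" where "e = Poly_Mapping.single i 1"
  have 1: "a - e + b = a + b - e" if "Poly_Mapping.lookup a i \<noteq> 0"
    by (rule poly_mapping_eqI)
       (use that in \<open>auto simp: e_def lookup_add lookup_minus lookup_single when_def\<close>)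
  have 2: "a + (b - e) = a + b - e" if "Poly_Mapping.lookup b i \<noteq> 0"
    by (rule poly_mapping_eqI)
       (use that in \<open>auto simp: e_def lookup_add lookup_minus lookup_single when_def\<close>)
  show ?thesis
    unfolding mult_single pdiff_single e_def[symmetric]
    using 1 2
    by (cases "Poly_Mapping.lookup a i = 0"; cases "Poly_Mapping.lookup b i = 0")
       (auto simp: lookup_add single_add[symmetric] algebra_simps)
qed

lemma pdiff_mult: "pdiff i (p * q) = pdiff i p * q + p * pdiff i q"
proof -
  let ?s = "\<lambda>p a. Poly_Mapping.single a (Poly_Mapping.lookup p a)"
  have "pdiff i ((\<Sum>a\<in>Poly_Mapping.keys p. ?s p a) * (\<Sum>b\<in>Poly_Mapping.keys q. ?s q b)) =
    pdiff i (\<Sum>a\<in>Poly_Mapping.keys p. ?s p a) * (\<Sum>b\<in>Poly_Mapping.keys q. ?s q b) +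
    (\<Sum>a\<in>Poly_Mapping.keys p. ?s p a) * pdiff i (\<Sum>b\<in>Poly_Mapping.keys q. ?s q b)"
    by (simp add: sum_product pdiff_sum pdiff_mult_single sum.distrib)
  then show ?thesis
    by (simp only: mpoly_as_sum[symmetric])
qed

lemma pdiff_X: "pdiff i (X j) = (if i = j then 1 else 0)"
  by (auto simp: X_def pdiff_single lookup_single)

lemma pdiff_Const [simp]: "pdiff i (Const c) = 0"
  by (simp add: Const_def pdiff_single)

lemma pdiff_of_nat [simp]: "pdiff i (of_nat n) = 0"
  using pdiff_Const[of i "of_nat n"] by (simp add: Const_def)

lemma pdiff_uminus: "pdiff i (- p) = - pdiff i p"
  using pdiff_add[of i p "- p"] by (simp add: eq_neg_iff_add_eq_0 add.commute)

definition rdiff :: "'n::{finite,linorder} \<Rightarrow> 'n ratfun \<Rightarrow> 'n ratfun" where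
  "rdiff i x = (THE y. \<exists>a b. b \<noteq> 0 \<and> x = Fract a b \<and>
     y = Fract (pdiff i a * b - a * pdiff i b) (b * b))"

lemma rdiff_Fract:
  assumes "b \<noteq> 0"
  shows "rdiff i (Fract a b) = Fract (pdiff i a * b - a * pdiff i b) (b * b)"
  unfolding rdiff_def
proof (rule the_equality)
  fix y assume "\<exists>c d. d \<noteq> 0 \<and> Fract a b = Fract c d \<and>
     y = Fract (pdiff i c * d - c * pdiff i d) (d * d)"
  then obtain c d where d: "d \<noteq> 0" "a * d = c * b"
      and y: "y = Fract (pdiff i c * d - c * pdiff i d) (d * d)"
    using assms by (auto simp: eq_fract)
  have "pdiff i (a * d) = pdiff i (c * b)" using d by simp
  then have e: "pdiff i a * d + a * pdiff i d = pdiff i c * b + c * pdiff i b"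
    by (simp add: pdiff_mult)
  have "(pdiff i a * b - a * pdiff i b) * (d * d) =
      b * d * (pdiff i a * d + a * pdiff i d) - b * pdiff i d * (a * d) - d * pdiff i b * (a * d)"
    by (simp add: algebra_simps)
  also have "\<dots> =
      b * d * (pdiff i c * b + c * pdiff i b) - b * pdiff i d * (c * b) - d * pdiff i b * (c * b)"
    unfolding e using d by simp
  also have "\<dots> = (pdiff i c * d - c * pdiff i d) * (b * b)"
    by (simp add: algebra_simps)
  finally show "y = Fract (pdiff i a * b - a * pdiff i b) (b * b)"
    using assms d by (simp add: y eq_fract)
qed (use assms in blast)

lemma rdiff_add: "rdiff i (x + y) = rdiff i x + rdiff i y"
proof -
  obtain a b where x: "x = Fract a b" "b \<noteq> 0" by (cases x) auto
  obtain c d where y: "y = Fract c d" "d \<noteq> 0" by (cases y) auto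
  show ?thesis using x y
    by (simp add: rdiff_Fract pdiff_add pdiff_mult eq_fract) (simp add: algebra_simps)
qed

lemma rdiff_mult: "rdiff i (x * y) = rdiff i x * y + x * rdiff i y"
proof -
  obtain a b where x: "x = Fract a b" "b \<noteq> 0" by (cases x) auto
  obtain c d where y: "y = Fract c d" "d \<noteq> 0" by (cases y) auto
  show ?thesis using x y
    by (simp add: rdiff_Fract pdiff_add pdiff_mult eq_fract) (simp add: algebra_simps)
qed

lemma rdiff_to_fract: "rdiff i (to_fract p) = to_fract (pdiff i p)"
  using pdiff_of_nat[of i 1] by (simp add: to_fract_def rdiff_Fract del: pdiff_of_nat)

lemma rdiff_0 [simp]: "rdiff i 0 = 0"
  using rdiff_add[of i 0 0] by (metis add_cancel_right_right)


section \<open>The two Weyl algebras\<close>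

text \<open>
  A Weyl algebra in characteristic zero acts faithfully on polynomials and on rational functions.
  It is realized as the algebra of operators generated by the constants, the variables
  and the partial derivatives: on polynomials in the \<open>z\<^sub>i\<close> for \<open>weyl_z\<close>, and on
  rational functions in the \<open>\<sigma>\<^sub>i\<close> for \<open>weyl_s\<close>. With the latter choice the localization
  of \<open>weyl_s\<close> at the discriminant consists of operators on the same space.
\<close>

definition weyl_z :: "('n::{finite,linorder} mpoly \<Rightarrow> 'n mpoly) ring" where
  "weyl_z = End_ring\<lparr>carrier := generate_ring End_ring
     (range (\<lambda>c. (*) (Const c)) \<union> range (\<lambda>i. (*) (X i)) \<union> range pdiff)\<rparr>"

definition weyl_s :: "('n::{finite,linorder} ratfun \<Rightarrow> 'n ratfun) ring" where
  "weyl_s = End_ring\<lparr>carrier := generate_ring End_ring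
     (range (\<lambda>c. (*) (to_fract (Const c))) \<union> range (\<lambda>i. (*) (to_fract (X i))) \<union> range rdiff)\<rparr>"

lemma weyl_s_gens_closed:
  "range (\<lambda>c. (*) (to_fract (Const c))) \<union> range (\<lambda>i. (*) (to_fract (X i))) \<union> range rdiff
     \<subseteq> carrier End_ring"
  by (auto simp: rdiff_add ring_distribs)

lemma ring_weyl_z: "ring (weyl_z :: ('n::{finite,linorder} mpoly \<Rightarrow> 'n mpoly) ring)"
proof -
  interpret E: ring "End_ring :: ('n mpoly \<Rightarrow> 'n mpoly) ring" by (rule ring_End_ring)
  show ?thesis unfolding weyl_z_def
    by (rule E.generate_ring_is_ring) (auto simp: pdiff_add ring_distribs)
qed

lemma ring_weyl_s: "ring (weyl_s :: ('n::{finite,linorder} ratfun \<Rightarrow> 'n ratfun) ring)"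
proof -
  interpret E: ring "End_ring :: ('n ratfun \<Rightarrow> 'n ratfun) ring" by (rule ring_End_ring)
  show ?thesis unfolding weyl_s_def
    by (rule E.generate_ring_is_ring[OF weyl_s_gens_closed])
qed

lemma weyl_s_simps [simp]:
  "mult weyl_s = (\<circ>)" "one weyl_s = id" "zero weyl_s = (\<lambda>_. 0)"
  "add weyl_s = (\<lambda>S T f. S f + T f)"
  by (simp_all add: weyl_s_def)

lemma weyl_s_additive: "Q \<in> carrier weyl_s \<Longrightarrow> Q (f + g) = Q f + Q g"
  using ring.generate_ring_in_carrier[OF ring_End_ring weyl_s_gens_closed, of Q]
  by (simp add: weyl_s_def)

lemma weyl_s_closed:
  "(*) (to_fract (Const c)) \<in> carrier weyl_s"
  "(*) (to_fract (X i)) \<in> carrier weyl_s"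
  "rdiff i \<in> carrier weyl_s"
  "id \<in> carrier weyl_s"
  "S \<in> carrier weyl_s \<Longrightarrow> T \<in> carrier weyl_s \<Longrightarrow> S \<circ> T \<in> carrier weyl_s"
  "S \<in> carrier weyl_s \<Longrightarrow> T \<in> carrier weyl_s \<Longrightarrow> (\<lambda>f. S f + T f) \<in> carrier weyl_s"
proof -
  show "S \<in> carrier weyl_s \<Longrightarrow> T \<in> carrier weyl_s \<Longrightarrow> S \<circ> T \<in> carrier weyl_s"
    "S \<in> carrier weyl_s \<Longrightarrow> T \<in> carrier weyl_s \<Longrightarrow> (\<lambda>f. S f + T f) \<in> carrier weyl_s"
    "id \<in> carrier weyl_s"
    using generate_ring.eng_mult[of S End_ring _ T] generate_ring.eng_add[of S End_ring _ T]
      generate_ring.one[of End_ring]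
    by (auto simp: weyl_s_def)
qed (auto simp: weyl_s_def intro!: generate_ring.incl)

lemma weyl_s_induct [consumes 1, case_names Const X rdiff add comp]:
  assumes "Q \<in> carrier weyl_s"
    and C: "\<And>c. P ((*) (to_fract (Const c)))"
    and "\<And>i. P ((*) (to_fract (X i)))" "\<And>i. P (rdiff i)"
    and "\<And>S T. S \<in> carrier weyl_s \<Longrightarrow> T \<in> carrier weyl_s \<Longrightarrow> P S \<Longrightarrow> P T \<Longrightarrow> P (\<lambda>f. S f + T f)"
    and comp: "\<And>S T. S \<in> carrier weyl_s \<Longrightarrow> T \<in> carrier weyl_s \<Longrightarrow> P S \<Longrightarrow> P T \<Longrightarrow> P (S \<circ> T)"
  shows "P Q"
proof -
  have "Q \<in> generate_ring End_ring
     (range (\<lambda>c. (*) (to_fract (Const c))) \<union> range (\<lambda>i. (*) (to_fract (X i))) \<union> range rdiff)"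
    using assms(1) by (simp add: weyl_s_def)
  then have "Q \<in> carrier weyl_s \<and> P Q"
  proof (induction rule: generate_ring.induct)
    case one
    have "(*) (to_fract (Const 1)) = (id :: 'a ratfun \<Rightarrow> 'a ratfun)"
      by (auto simp: Const_def fun_eq_iff)
    then show ?case using C[of 1] weyl_s_closed(4) by (metis End_ring_simps(3))
  next
    case (incl h)
    then show ?case using assms weyl_s_closed by auto
  next
    case (a_inv h)
    have m: "to_fract (Const (-1)) = (-1 :: 'a ratfun)"
      by (simp add: Const_def single_uminus)
    have "\<ominus>\<^bsub>End_ring\<^esub> h = (*) (to_fract (Const (-1))) \<circ> h"
      using a_inv_End_ring[of h] weyl_s_additive[of h] a_inv
      by (auto simp: fun_eq_iff m)
    then show ?case using comp[OF weyl_s_closed(1) _ C, of h] weyl_s_closed(5)[OF weyl_s_closed(1)] a_inv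
      by metis
  next
    case (eng_add h1 h2)
    then show ?case using assms(5)[of h1 h2] weyl_s_closed(6)[of h1 h2] by simp
  next
    case (eng_mult h1 h2)
    then show ?case using comp[of h1 h2] weyl_s_closed(5)[of h1 h2] by (metis End_ring_simps(2))
  qed
  then show ?thesis by simp
qed


section \<open>Symmetric polynomials, and symmetric differential operators as elements of \<open>weyl_s\<close>\<close>

text \<open>Invariance under the permutation \<open>w\<close> means \<open>w \<circ> P \<circ> w\<^sup>-\<^sup>1 = P\<close>: conjugation by the
  substitution \<open>X i \<mapsto> X (w i)\<close> sends \<open>X i\<close> to \<open>X (w i)\<close> and \<open>pdiff i\<close> to \<open>pdiff (w i)\<close>.\<close>

definition weyl_z_sym :: "('n::{finite,linorder} mpoly \<Rightarrow> 'n mpoly) set" where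
  "weyl_z_sym = {P \<in> carrier weyl_z. \<forall>w. bij w \<longrightarrow>
     subst (\<lambda>i. X (w i)) \<circ> P = P \<circ> subst (\<lambda>i. X (w i))}"

definition esym :: "nat \<Rightarrow> 'n::finite mpoly" where
  "esym m = (\<Sum>S | card S = m. \<Prod>i\<in>S. X i)"

definition rank :: "'n::{finite,linorder} \<Rightarrow> nat" where
  "rank i = card {j. j \<le> i}"

text \<open>The isomorphism from \<open>\<complex>[\<sigma>]\<close> onto the symmetric polynomials in the \<open>z\<^sub>i\<close>: the formal
  variable \<open>X i\<close> stands for the elementary symmetric polynomial of degree \<open>rank i\<close>.\<close>

definition esym_subst :: "'n::{finite,linorder} mpoly \<Rightarrow> 'n mpoly" where
  "esym_subst = subst (\<lambda>i. esym (rank i))"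

definition vandermonde :: "'n::{finite,linorder} mpoly" where
  "vandermonde = (\<Prod>(i, j)\<in>{(i, j). i < j}. X i - X j)"

definition discr :: "'n::{finite,linorder} mpoly" where
  "discr = (THE d. esym_subst d = vandermonde ^ 2)"

text \<open>The element of \<open>weyl_s\<close> acting on \<open>\<complex>[\<sigma>]\<close> as the invariant operator \<open>P\<close> acts on
  symmetric polynomials.\<close>

definition weyl_embed ::
    "('n::{finite,linorder} mpoly \<Rightarrow> 'n mpoly) \<Rightarrow> 'n ratfun \<Rightarrow> 'n ratfun" where
  "weyl_embed P = (THE Q. Q \<in> carrier weyl_s \<and>
     (\<forall>f. \<exists>g. Q (to_fract f) = to_fract g \<and> esym_subst g = P (esym_subst f)))"

text \<open>\<open>localize (carrier weyl_s)\<close> is the localized algebra \<open>[\<Delta>\<^sup>-\<^sup>1]W\<^sub>2\<close>, and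
  \<open>localize (weyl_embed ` ann_sym)\<close> is \<open>[\<Delta>\<^sup>-\<^sup>1]\<I>\<close>.\<close>

definition localize ::
    "('n::{finite,linorder} ratfun \<Rightarrow> 'n ratfun) set \<Rightarrow> ('n ratfun \<Rightarrow> 'n ratfun) set" where
  "localize S = (\<Union>m. (\<lambda>Q f. Q f / to_fract discr ^ m) ` S)"


section \<open>The module generated by the square root of the discriminant\<close>

text \<open>
  The element \<open>f \<delta>\<close> is represented by the coefficient \<open>f\<close>, so \<open>\<delta>\<close> itself is \<open>1\<close>. The connection
  is defined for all rational coefficients \<open>f\<close>; the module of interest is the set
  \<open>delta_module\<close>, which is stable under it (\<open>left_submodule_delta_module\<close>).
\<close>

definition delta_module :: "'n::{finite,linorder} ratfun set" where
  "delta_module = {to_fract a / to_fract discr ^ m | a m. True}"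

definition delta_conn :: "'n::{finite,linorder} \<Rightarrow> 'n ratfun \<Rightarrow> 'n ratfun" where
  "delta_conn i f = rdiff i f + f * (rdiff i (to_fract discr) / (2 * to_fract discr))"

definition is_delta_action ::
    "(('n::{finite,linorder} ratfun \<Rightarrow> 'n ratfun) \<Rightarrow> 'n ratfun \<Rightarrow> 'n ratfun) \<Rightarrow> bool" where
  "is_delta_action \<rho> \<longleftrightarrow>
     \<rho> \<in> ring_hom weyl_s End_ring \<and> \<rho> \<in> extensional (carrier weyl_s) \<and>
     (\<forall>c. \<rho> ((*) (to_fract (Const c))) = (*) (to_fract (Const c))) \<and>
     (\<forall>i. \<rho> ((*) (to_fract (X i))) = (*) (to_fract (X i))) \<and>
     (\<forall>i. \<rho> (rdiff i) = delta_conn i)"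

definition delta_act ::
    "('n::{finite,linorder} ratfun \<Rightarrow> 'n ratfun) \<Rightarrow> 'n ratfun \<Rightarrow> 'n ratfun" where
  "delta_act = (THE \<rho>. is_delta_action \<rho>)"

definition ann_sym :: "('n::{finite,linorder} mpoly \<Rightarrow> 'n mpoly) set" where
  "ann_sym = {P \<in> weyl_z_sym. P vandermonde = 0}"

definition ann_delta :: "('n::{finite,linorder} ratfun \<Rightarrow> 'n ratfun) set" where
  "ann_delta = {Q \<in> carrier weyl_s. delta_act Q 1 = 0}"

definition delta_submodule :: "'n::{finite,linorder} ratfun set" where
  "delta_submodule = {delta_act Q 1 | Q. Q \<in> carrier weyl_s}"


subsection \<open>Existence and uniqueness of the action\<close>

text \<open>
  Conjugating \<open>rdiff i\<close> by \<open>\<Delta>\<^sup>n\<close> gives \<open>rdiff i + n (\<partial>\<^sub>i \<Delta>) / \<Delta>\<close>, and the conjugates of any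
  element of \<open>weyl_s\<close> depend polynomially on \<open>n\<close>. Interpolating at \<open>n = 1/2\<close> gives the action.
\<close>

definition conn_rel where
  "conn_rel d Q R \<longleftrightarrow> (\<exists>T :: 'n::{finite,linorder} ratfun poly \<Rightarrow> 'n ratfun poly. \<forall>F.
     (\<forall>n::nat. poly (T F) (of_nat n) * d ^ n = Q (poly F (of_nat n) * d ^ n)) \<and>
     poly (T F) (1/2) = R (poly F (1/2)))"

lemma of_nat_ratfun_eq_iff: "(of_nat m :: 'n::{finite,linorder} ratfun) = of_nat n \<longleftrightarrow> m = n"
  by (simp add: of_nat_fract eq_fract)

lemma two_ratfun: "(2 :: 'n::{finite,linorder} ratfun) \<noteq> 0"
  using of_nat_ratfun_eq_iff[of 2 0] by simp

lemma poly_eqI_nat: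
  fixes p q :: "'n::{finite,linorder} ratfun poly"
  assumes "\<And>n::nat. poly p (of_nat n) = poly q (of_nat n)"
  shows "p = q"
proof (rule ccontr)
  assume "p \<noteq> q"
  then have "finite {x. poly (p - q) x = 0}" by (intro poly_roots_finite) auto
  moreover have "range (of_nat :: nat \<Rightarrow> 'n ratfun) \<subseteq> {x. poly (p - q) x = 0}"
    using assms by auto
  moreover have "inj (of_nat :: nat \<Rightarrow> 'n ratfun)"
    by (auto simp: inj_def of_nat_ratfun_eq_iff)
  ultimately show False
    using finite_subset infinite_UNIV_nat finite_imageD by blast
qed

lemma conn_rel_unique:
  fixes d :: "'n::{finite,linorder} ratfun"
  assumes "conn_rel d Q R" "conn_rel d Q R'" "d \<noteq> 0"
  shows "R = R'"
proof
  fix f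
  obtain T where T: "\<And>F n. poly (T F) (of_nat n) * d ^ n = Q (poly F (of_nat n) * d ^ n)"
      "\<And>F. poly (T F) (1/2) = R (poly F (1/2))"
    using assms(1) unfolding conn_rel_def by blast
  obtain T' where T': "\<And>F n. poly (T' F) (of_nat n) * d ^ n = Q (poly F (of_nat n) * d ^ n)"
      "\<And>F. poly (T' F) (1/2) = R' (poly F (1/2))"
    using assms(2) unfolding conn_rel_def by blast
  have "T [:f:] = T' [:f:]"
  proof (rule poly_eqI_nat)
    fix n :: nat
    have "poly (T [:f:]) (of_nat n) * d ^ n = poly (T' [:f:]) (of_nat n) * d ^ n"
      by (simp only: T(1) T'(1))
    then show "poly (T [:f:]) (of_nat n) = poly (T' [:f:]) (of_nat n)"
      using assms(3) by simp
  qed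
  then show "R f = R' f" using T(2)[of "[:f:]"] T'(2)[of "[:f:]"] by simp
qed

lemma conn_rel_add:
  assumes "conn_rel d Q R" "conn_rel d Q' R'"
  shows "conn_rel d (\<lambda>f. Q f + Q' f) (\<lambda>f. R f + R' f)"
proof -
  obtain T where T: "\<forall>F. (\<forall>n. poly (T F) (of_nat n) * d ^ n = Q (poly F (of_nat n) * d ^ n)) \<and>
     poly (T F) (1/2) = R (poly F (1/2))"
    using assms(1) unfolding conn_rel_def by blast
  obtain T' where T': "\<forall>F. (\<forall>n. poly (T' F) (of_nat n) * d ^ n = Q' (poly F (of_nat n) * d ^ n)) \<and>
     poly (T' F) (1/2) = R' (poly F (1/2))"
    using assms(2) unfolding conn_rel_def by blast
  show ?thesis unfolding conn_rel_def
    by (intro exI[of _ "\<lambda>F. T F + T' F"]) (use T T' in \<open>simp add: ring_distribs\<close>)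
qed

lemma conn_rel_comp:
  assumes "conn_rel d Q R" "conn_rel d Q' R'"
  shows "conn_rel d (Q \<circ> Q') (R \<circ> R')"
proof -
  obtain T where T: "\<forall>F. (\<forall>n. poly (T F) (of_nat n) * d ^ n = Q (poly F (of_nat n) * d ^ n)) \<and>
     poly (T F) (1/2) = R (poly F (1/2))"
    using assms(1) unfolding conn_rel_def by blast
  obtain T' where T': "\<forall>F. (\<forall>n. poly (T' F) (of_nat n) * d ^ n = Q' (poly F (of_nat n) * d ^ n)) \<and>
     poly (T' F) (1/2) = R' (poly F (1/2))"
    using assms(2) unfolding conn_rel_def by blast
  show ?thesis unfolding conn_rel_def
    by (intro exI[of _ "\<lambda>F. T (T' F)"]) (use T T' in simp)
qed

lemma conn_rel_mult: "conn_rel d ((*) c) ((*) c)"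
  unfolding conn_rel_def
  by (intro exI[of _ "\<lambda>F. Polynomial.smult c F"]) (simp add: mult.assoc)

lemma rdiff_of_nat [simp]: "rdiff i (of_nat n) = 0"
  using rdiff_to_fract[of i "of_nat n"] by (simp add: to_fract_def of_nat_fract fract_collapse)

lemma rdiff_1 [simp]: "rdiff i 1 = 0"
  using rdiff_of_nat[of i 1] by (simp del: rdiff_of_nat)

lemma rdiff_half: "rdiff i (1/2 :: 'n::{finite,linorder} ratfun) = 0"
proof -
  have "rdiff i (of_nat 2 * (1/2 :: 'n ratfun)) = of_nat 2 * rdiff i (1/2)"
    by (simp only: rdiff_mult rdiff_of_nat mult_zero_left add_0)
  moreover have "of_nat 2 * (1/2) = (1 :: 'n ratfun)"
    using two_ratfun by simp
  ultimately have "2 * rdiff i (1/2 :: 'n ratfun) = 0" by simp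
  then show ?thesis using two_ratfun by (metis mult_eq_0_iff)
qed

lemma rdiff_power:
  "d \<noteq> 0 \<Longrightarrow> rdiff i (d ^ n) = of_nat n * (rdiff i d / d) * d ^ n"
proof (induction n)
  case 0
  then show ?case by simp
next
  case (Suc n)
  then show ?case by (simp add: rdiff_mult field_simps)
qed

lemma poly_map_rdiff:
  assumes "rdiff i s = 0"
  shows "poly (map_poly (rdiff i) F) s = rdiff i (poly F s)"
  by (induction F) (auto simp: map_poly_pCons rdiff_add rdiff_mult assms)

lemma conn_rel_rdiff:
  assumes "d \<noteq> 0"
  shows "conn_rel d (rdiff i) (\<lambda>f. rdiff i f + f * (rdiff i d / (2 * d)))"
  unfolding conn_rel_def
  by (intro exI[of _ "\<lambda>F. map_poly (rdiff i) F + Polynomial.smult (rdiff i d / d) (pCons 0 F)"])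
     (use assms two_ratfun in
       \<open>auto simp: poly_map_rdiff rdiff_half rdiff_mult rdiff_power field_simps\<close>)

lemma ex1_delta_action: "\<exists>!\<rho>. is_delta_action (\<rho> :: ('n::{finite,linorder} ratfun \<Rightarrow> 'n ratfun) \<Rightarrow> _)"
proof -
  define d :: "'n ratfun" where "d = (if discr = (0 :: 'n mpoly) then 1 else to_fract discr)"
  have d0: "d \<noteq> 0" by (simp add: d_def)
  have "rdiff i d / (2 * d) = rdiff i (to_fract discr) / (2 * to_fract discr)" for i
    by (auto simp: d_def)
  then have conn: "delta_conn i = (\<lambda>f. rdiff i f + f * (rdiff i d / (2 * d)))" for i
    by (simp add: delta_conn_def fun_eq_iff)
  have ex: "\<exists>R. conn_rel d Q R \<and> R \<in> carrier End_ring" if "Q \<in> carrier weyl_s" for Q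
    using that
  proof (induction rule: weyl_s_induct)
    case (Const c)
    show ?case by (rule exI, rule conjI, rule conn_rel_mult) (auto simp: ring_distribs)
  next
    case (X i)
    show ?case by (rule exI, rule conjI, rule conn_rel_mult) (auto simp: ring_distribs)
  next
    case (rdiff i)
    show ?case
      by (rule exI, rule conjI, rule conn_rel_rdiff[OF d0])
         (auto simp: rdiff_add ring_distribs add_divide_distrib)
  next
    case (add S T)
    then obtain R R' where "conn_rel d S R" "conn_rel d T R'" "R \<in> carrier End_ring" "R' \<in> carrier End_ring"
      by blast
    then show ?case
      by (intro exI[of _ "\<lambda>f. R f + R' f"] conjI conn_rel_add) auto
  next
    case (comp S T)
    then obtain R R' where "conn_rel d S R" "conn_rel d T R'" "R \<in> carrier End_ring" "R' \<in> carrier End_ring"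
      by blast
    then show ?case
      by (intro exI[of _ "R \<circ> R'"] conjI conn_rel_comp) auto
  qed
  define \<rho> where "\<rho> = restrict (\<lambda>Q. THE R. conn_rel d Q R) (carrier weyl_s)"
  have \<rho>I: "\<rho> Q = R" if "Q \<in> carrier weyl_s" "conn_rel d Q R" for Q R
    using that conn_rel_unique[OF _ _ d0] by (auto simp: \<rho>_def intro!: the_equality)
  have \<rho>: "conn_rel d Q (\<rho> Q) \<and> \<rho> Q \<in> carrier End_ring" if "Q \<in> carrier weyl_s" for Q
    using ex[OF that] \<rho>I[OF that] by blast
  have "\<rho> \<in> ring_hom weyl_s End_ring"
  proof (rule ring_hom_memI)
    fix S T :: "'n ratfun \<Rightarrow> 'n ratfun" assume ST: "S \<in> carrier weyl_s" "T \<in> carrier weyl_s"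
    show "\<rho> (S \<otimes>\<^bsub>weyl_s\<^esub> T) = \<rho> S \<otimes>\<^bsub>End_ring\<^esub> \<rho> T"
      using ST \<rho>I[OF weyl_s_closed(5)[OF ST] conn_rel_comp] \<rho> by simp
    show "\<rho> (S \<oplus>\<^bsub>weyl_s\<^esub> T) = \<rho> S \<oplus>\<^bsub>End_ring\<^esub> \<rho> T"
      using ST \<rho>I[OF weyl_s_closed(6)[OF ST] conn_rel_add] \<rho> by simp
  next
    have "(id :: 'n ratfun \<Rightarrow> _) = (*) 1" by auto
    then have "conn_rel d id id" using conn_rel_mult[of d 1] by simp
    then show "\<rho> \<one>\<^bsub>weyl_s\<^esub> = \<one>\<^bsub>End_ring\<^esub>"
      using \<rho>I[OF weyl_s_closed(4)] by simp
  qed (use \<rho> in blast)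
  then have main: "is_delta_action \<rho>"
    unfolding is_delta_action_def
    using \<rho>I[OF weyl_s_closed(1) conn_rel_mult] \<rho>I[OF weyl_s_closed(2) conn_rel_mult]
      \<rho>I[OF weyl_s_closed(3) conn_rel_rdiff[OF d0]]
    by (auto simp: conn) (auto simp: \<rho>_def)
  have uniq: "\<rho>' = \<rho>" if r: "is_delta_action \<rho>'" for \<rho>'
  proof (rule extensionalityI)
    show "\<rho>' \<in> extensional (carrier weyl_s)" "\<rho> \<in> extensional (carrier weyl_s)"
      using r main by (simp_all add: is_delta_action_def)
    fix Q :: "'n ratfun \<Rightarrow> 'n ratfun" assume "Q \<in> carrier weyl_s"
    then show "\<rho>' Q = \<rho> Q"
    proof (induction rule: weyl_s_induct)
      case (add S T)
      then show ?case
        using r main ring_hom_add[of \<rho> weyl_s End_ring S T] ring_hom_add[of \<rho>' weyl_s End_ring S T]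
        by (simp add: is_delta_action_def)
    next
      case (comp S T)
      then show ?case
        using r main ring_hom_mult[of \<rho> weyl_s End_ring S T] ring_hom_mult[of \<rho>' weyl_s End_ring S T]
        unfolding is_delta_action_def weyl_s_simps End_ring_simps by metis
    qed (use r main in \<open>simp_all add: is_delta_action_def\<close>)
  qed
  show ?thesis using main uniq by blast
qed

lemma is_delta_action_delta_act: "is_delta_action delta_act"
  unfolding delta_act_def by (rule theI'[OF ex1_delta_action])

lemma left_submodule_delta_module:
  "left_submodule weyl_s delta_act (delta_module :: 'n::{finite,linorder} ratfun set)"
proof -
  define p :: "'n mpoly" where "p = (if discr = (0 :: 'n mpoly) then 1 else discr)"
  define d where "d = to_fract p"
  have d0: "d \<noteq> 0" by (simp add: p_def d_def)
  have M: "x \<in> delta_module \<longleftrightarrow> (\<exists>a m. x * d ^ m = to_fract a)" for x :: "'n ratfun"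
  proof (cases "discr = (0 :: 'n mpoly)")
    case True
    have "to_fract a / 0 ^ m \<in> range (to_fract :: 'n mpoly \<Rightarrow> _)" for a :: "'n mpoly" and m
      using rangeI[of to_fract "0 :: 'n mpoly"] by (cases m) auto
    moreover have "\<exists>m. to_fract a = to_fract a / 0 ^ m" for a :: "'n mpoly"
      by (rule exI[of _ 0]) simp
    ultimately show ?thesis using True
      unfolding delta_module_def by (fastforce simp: p_def d_def)
  next
    case False
    then show ?thesis
      using d0 by (auto simp: delta_module_def p_def d_def eq_divide_eq)
  qed
  have "rdiff i d / (2 * d) = rdiff i (to_fract discr) / (2 * to_fract discr)" for i
    by (auto simp: d_def p_def)
  then have conn: "delta_conn i f = rdiff i f + f * (rdiff i d / (2 * d))" for i f
    by (simp add: delta_conn_def)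
  have to_fract_pow: "to_fract (q ^ n) = (to_fract q :: 'n ratfun) ^ n" for q n
    by (induction n) auto
  have minus: "x - y \<in> delta_module" if "x \<in> delta_module" "y \<in> delta_module" for x y :: "'n ratfun"
  proof -
    obtain a m b k where "x * d ^ m = to_fract a" "y * d ^ k = to_fract b"
      using \<open>x \<in> _\<close> \<open>y \<in> _\<close> by (auto simp: M)
    moreover have "(x - y) * d ^ (m + k) = (x * d ^ m) * d ^ k - (y * d ^ k) * d ^ m"
      by (simp add: power_add algebra_simps)
    ultimately have "(x - y) * d ^ (m + k) = to_fract (a * p ^ k - b * p ^ m)"
      by (simp add: to_fract_pow d_def)
    then show ?thesis using M by blast
  qed
  have zero: "0 \<in> (delta_module :: 'n ratfun set)"
    by (auto simp: M intro!: exI[of _ 0])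
  have mult: "to_fract c * x \<in> delta_module" if x: "x \<in> delta_module" for c and x :: "'n ratfun"
  proof -
    obtain a m where "x * d ^ m = to_fract a" using x by (auto simp: M)
    then have "to_fract c * x * d ^ m = to_fract (c * a)" by (simp add: mult.assoc)
    then show ?thesis using M by blast
  qed
  have conn_closed: "delta_conn i x \<in> delta_module" if x: "x \<in> delta_module" for i and x :: "'n ratfun"
  proof -
    obtain a m where a: "x * d ^ m = to_fract a" using x by (auto simp: M)
    have "rdiff i x * d ^ m + x * (of_nat m * (rdiff i d / d) * d ^ m) = to_fract (pdiff i a)"
      using arg_cong[OF a, of "rdiff i"] by (simp add: rdiff_mult rdiff_power[OF d0] rdiff_to_fract)
    then have *: "rdiff i x * d ^ m = to_fract (pdiff i a) - of_nat m * (rdiff i d / d) * to_fract a"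
      by (simp add: a[symmetric] algebra_simps)
    have h: "(1/2 :: 'n ratfun) = to_fract (Const (1/2))"
    proof -
      have "Const (1/2) + Const (1/2) = (1 :: 'n mpoly)"
        by (simp add: Const_def flip: single_add)
      then have "to_fract (Const (1/2)) + to_fract (Const (1/2)) = (1 :: 'n ratfun)"
        by (simp only: to_fract_add[symmetric] to_fract_1)
      then have "2 * to_fract (Const (1/2)) = (1 :: 'n ratfun)"
        by (simp only: mult_2)
      then show ?thesis using two_ratfun[where 'n = 'n] by (simp add: divide_eq_eq mult.commute)
    qed
    have "delta_conn i x * d ^ Suc m =
        rdiff i x * d ^ m * d + (x * d ^ m) * ((1/2) * rdiff i d)"
      using d0 two_ratfun by (simp add: conn field_simps)
    also have "\<dots> = to_fract (pdiff i a) * d - of_nat m * rdiff i d * to_fract a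
        + to_fract a * ((1/2) * rdiff i d)"
      using d0 by (simp only: * a) (simp add: field_simps)
    also have "\<dots> = to_fract (pdiff i a * p - of_nat m * pdiff i p * a + a * (Const (1/2) * pdiff i p))"
      unfolding h d_def rdiff_to_fract by (simp add: of_nat_fract to_fract_def)
    finally show ?thesis using M by blast
  qed
  have A: "is_delta_action (delta_act :: ('n ratfun \<Rightarrow> 'n ratfun) \<Rightarrow> _)"
    by (rule is_delta_action_delta_act)
  have act: "delta_act Q x \<in> delta_module"
    if "Q \<in> carrier weyl_s" "x \<in> delta_module" for Q and x :: "'n ratfun"
    using that
  proof (induction arbitrary: x rule: weyl_s_induct)
    case (add S T)
    have "delta_act (\<lambda>f. S f + T f) = (\<lambda>f. delta_act S f + delta_act T f)"
      using add A ring_hom_add[of delta_act weyl_s End_ring S T]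
      by (simp add: is_delta_action_def)
    moreover have "delta_act S x - (0 - delta_act T x) \<in> delta_module"
      using add by (intro minus zero) auto
    ultimately show ?case by simp
  next
    case (comp S T)
    then show ?case
      using A ring_hom_mult[of delta_act weyl_s End_ring S T]
      unfolding is_delta_action_def weyl_s_simps End_ring_simps by (metis comp_apply)
  qed (use A mult conn_closed in \<open>simp_all add: is_delta_action_def\<close>)
  show ?thesis
    unfolding left_submodule_def using zero minus act by blast
qed

end

theory Submission
  imports "HOL-Analysis.Cartesian_Space" Defs
begin

text \<open>
  The derivation \<open>\<partial>/\<partial>\<sigma>\<^sub>j\<close> extends uniquely to \<open>\<complex>(z)\<close>, as a combination of the
  \<open>\<partial>/\<partial>z\<^sub>i\<close> whose coefficients have denominators dividing the discriminant; applied to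
  \<open>f \<delta>\<close> the extension is the connection. Hence every \<open>Q\<close> in \<open>weyl_s\<close> lifts to an operator on
  \<open>\<complex>(z)\<close>, and some \<open>\<Delta>\<^sup>N Q\<close> lifts to an element of \<open>weyl_z_sym\<close>. Conversely
  \<open>\<partial>/\<partial>z\<^sub>i\<close> is a polynomial combination of the lifts of the \<open>\<partial>/\<partial>\<sigma>\<^sub>j\<close>, so
  averaging over permutations exhibits every element of \<open>weyl_z_sym\<close> as the lift of an element of
  \<open>weyl_s\<close>. This identifies the two annihilators up to powers of \<open>\<Delta>\<close>. For simplicity, a nonzero
  submodule contains some nonzero \<open>p \<delta>\<close> with \<open>p\<close> a polynomial; an operator in \<open>weyl_z\<close> maps
  this to \<open>1\<close>, and averaging its product with \<open>\<delta>\<close> gives an invariant operator that maps it to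
  \<open>\<delta>\<close>.
\<close>

section \<open>Polynomials and substitutions\<close>

lemma Const_add: "Const (c + d) = Const c + Const d"
  by (simp add: Const_def single_add)

lemma Const_mult: "Const (c * d) = Const c * Const d"
  by (simp add: Const_def mult_single)

lemma Const_0 [simp]: "Const 0 = 0"
  by (simp add: Const_def)

lemma Const_1 [simp]: "Const 1 = 1"
  by (simp add: Const_def)

lemma Const_eq_0_iff: "Const c = 0 \<longleftrightarrow> c = 0"
  by (metis Const_0 Const_def lookup_single_eq)

lemma Const_of_nat: "Const (of_nat n) = of_nat n"
  by (simp add: Const_def)

lemma X_power: "X i ^ n = (Poly_Mapping.single (Poly_Mapping.single i n) 1 :: 'n mpoly)"
  by (induction n) (simp_all add: X_def mult_single flip: single_add)

lemma prod_single_1: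
  "(\<Prod>i\<in>S. Poly_Mapping.single (f i) 1) = (Poly_Mapping.single (sum f S) 1 :: 'n mpoly)"
  by (induction S rule: infinite_finite_induct) (simp_all add: mult_single)

lemma single_conv_prod:
  fixes a :: "'n::finite \<Rightarrow>\<^sub>0 nat"
  shows "Poly_Mapping.single a c = Const c * (\<Prod>i\<in>UNIV. X i ^ Poly_Mapping.lookup a i)"
proof -
  have "(\<Sum>i\<in>UNIV. Poly_Mapping.single i (Poly_Mapping.lookup a i)) = a"
    by (rule poly_mapping_eqI) (simp add: lookup_sum lookup_single when_def)
  then show ?thesis
    by (simp add: X_power prod_single_1 Const_def mult_single)
qed

text \<open>Monomial expansion reduces every polynomial to constants and variables. Identities
  between substitutions or derivations then need checking on these generators only.\<close>

lemma mpoly_induct [case_names Const X add mult]: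
  fixes p :: "'n::finite mpoly"
  assumes "\<And>c. P (Const c)" "\<And>i. P (X i)"
    and add: "\<And>p q. P p \<Longrightarrow> P q \<Longrightarrow> P (p + q)"
    and mult: "\<And>p q. P p \<Longrightarrow> P q \<Longrightarrow> P (p * q)"
  shows "P p"
proof -
  have 1: "P 1" and 0: "P 0"
    using assms(1)[of 1] assms(1)[of 0] by simp_all
  have pow: "P (X i ^ n)" for i n
    by (induction n) (use 1 assms in auto)
  have prod: "P (\<Prod>i\<in>S. X i ^ f i)" for S f
    by (induction S rule: infinite_finite_induct) (use 1 pow mult in auto)
  have "P (\<Sum>a\<in>S. Poly_Mapping.single a (f a))" for S :: "('n \<Rightarrow>\<^sub>0 nat) set" and f
    by (induction S rule: infinite_finite_induct)
       (use 0 add mult assms(1) prod in \<open>auto simp: single_conv_prod\<close>)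
  then show ?thesis
    using mpoly_as_sum[of p] by metis
qed

lemma subst_superset:
  assumes "finite A" "Poly_Mapping.keys p \<subseteq> A"
  shows "subst g p = (\<Sum>a\<in>A. Const (Poly_Mapping.lookup p a) * (\<Prod>i\<in>UNIV. g i ^ Poly_Mapping.lookup a i))"
  unfolding subst_def
  by (rule sum_keys_superset[where F = "\<lambda>a c. Const c * (\<Prod>i\<in>UNIV. g i ^ Poly_Mapping.lookup a i)"])
     (use assms in auto)

lemma subst_single:
  "subst g (Poly_Mapping.single a c) = Const c * (\<Prod>i\<in>UNIV. g i ^ Poly_Mapping.lookup a i)"
  by (subst subst_superset[of "{a}"]) auto

lemma subst_0 [simp]: "subst g 0 = 0"
  by (simp add: subst_def)

lemma subst_Const [simp]: "subst g (Const c) = Const c"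
  unfolding Const_def by (subst subst_single) (simp add: Const_def)

lemma subst_1 [simp]: "subst g 1 = 1"
  using subst_Const[of g 1] by simp

lemma subst_X [simp]: "subst g (X i) = g i"
proof -
  have "subst g (X i) = (\<Prod>j\<in>UNIV. g j ^ (if i = j then 1 else 0))"
    unfolding X_def subst_single by (auto simp: lookup_single intro!: prod.cong)
  also have "\<dots> = (\<Prod>j\<in>UNIV. if i = j then g j else 1)"
    by (rule prod.cong) auto
  finally show ?thesis by simp
qed

lemma subst_add: "subst g (p + q) = subst g p + subst g q"
proof -
  define A where "A = Poly_Mapping.keys p \<union> Poly_Mapping.keys q"
  have A: "finite A" "Poly_Mapping.keys p \<subseteq> A" "Poly_Mapping.keys q \<subseteq> A"
    "Poly_Mapping.keys (p + q) \<subseteq> A"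
    using Poly_Mapping.keys_add[of p q] by (auto simp: A_def)
  show ?thesis
    using A by (simp add: subst_superset[of A] lookup_add Const_add ring_distribs sum.distrib)
qed

lemma subst_sum: "subst g (sum f A) = (\<Sum>a\<in>A. subst g (f a))"
  by (induction A rule: infinite_finite_induct) (auto simp: subst_add)

lemma subst_mult: "subst g (p * q) = subst g p * subst g q"
proof -
  let ?s = "\<lambda>p a. Poly_Mapping.single a (Poly_Mapping.lookup p a)"
  have *: "subst g (Poly_Mapping.single a c * Poly_Mapping.single b d) =
      subst g (Poly_Mapping.single a c) * subst g (Poly_Mapping.single b d)" for a b c d
    by (simp add: mult_single subst_single lookup_add power_add prod.distrib Const_mult)
  have "subst g ((\<Sum>a\<in>Poly_Mapping.keys p. ?s p a) * (\<Sum>b\<in>Poly_Mapping.keys q. ?s q b)) =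
    subst g (\<Sum>a\<in>Poly_Mapping.keys p. ?s p a) * subst g (\<Sum>b\<in>Poly_Mapping.keys q. ?s q b)"
    by (simp add: sum_product subst_sum *)
  then show ?thesis
    by (simp only: mpoly_as_sum[symmetric])
qed

lemma subst_uminus: "subst g (- p) = - subst g p"
  using subst_add[of g p "- p"] by (simp add: eq_neg_iff_add_eq_0 add.commute)

lemma subst_diff: "subst g (p - q) = subst g p - subst g q"
  using subst_add[of g p "- q"] by (simp add: subst_uminus)

lemma subst_prod: "subst g (prod f A) = (\<Prod>a\<in>A. subst g (f a))"
  by (induction A rule: infinite_finite_induct) (auto simp: subst_mult)

lemma subst_power: "subst g (p ^ n) = subst g p ^ n"
  by (induction n) (auto simp: subst_mult)

lemma subst_subst: "subst g (subst h p) = subst (\<lambda>i. subst g (h i)) p"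
  by (induction p rule: mpoly_induct) (auto simp: subst_add subst_mult)

lemma subst_X_id: "subst X p = p"
  by (induction p rule: mpoly_induct) (auto simp: subst_add subst_mult)

lemma X_inject: "X i = (X j :: 'n mpoly) \<longleftrightarrow> i = j"
  using pdiff_X[of i i] pdiff_X[of i j] by (metis one_neq_zero)

lemma pdiff_prod:
  assumes "finite S"
  shows "pdiff i (prod f S) = (\<Sum>s\<in>S. pdiff i (f s) * prod f (S - {s}))"
  using assms
proof (induction S)
  case empty
  show ?case using pdiff_Const[of i 1] by simp
next
  case (insert x S)
  have "(\<Sum>s\<in>S. pdiff i (f s) * prod f (insert x S - {s})) =
      f x * (\<Sum>s\<in>S. pdiff i (f s) * prod f (S - {s}))"
    unfolding sum_distrib_left
  proof (rule sum.cong)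
    fix s assume "s \<in> S"
    then have "insert x S - {s} = insert x (S - {s})" using insert by auto
    then show "pdiff i (f s) * prod f (insert x S - {s}) = f x * (pdiff i (f s) * prod f (S - {s}))"
      using insert by (simp add: mult_ac)
  qed simp
  then show ?case
    using insert by (simp add: pdiff_mult)
qed

text \<open>Differentiating lowers the degree until a nonzero constant remains.\<close>

lemma const_in_deriv_closed:
  fixes p :: "'n::finite mpoly"
  assumes "p \<noteq> 0" "p \<in> I" and closed: "\<And>i p. p \<in> I \<Longrightarrow> pdiff i p \<in> I"
  shows "\<exists>c. c \<noteq> 0 \<and> Const c \<in> I"
proof -
  have lookup_pdiff: "Poly_Mapping.lookup (pdiff i p) b =
      of_nat (Poly_Mapping.lookup b i + 1) * Poly_Mapping.lookup p (b + Poly_Mapping.single i 1)"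
    for i and p :: "'n mpoly" and b
  proof -
    let ?e = "Poly_Mapping.single i (1::nat)"
    have iff: "a - ?e = b \<longleftrightarrow> a = b + ?e" if "Poly_Mapping.lookup a i \<noteq> 0" for a
    proof
      assume "a - ?e = b"
      show "a = b + ?e"
        unfolding \<open>a - ?e = b\<close>[symmetric] by (rule poly_mapping_eqI)
          (use that in \<open>auto simp: lookup_add lookup_minus lookup_single when_def\<close>)
    qed simp
    have "Poly_Mapping.lookup (pdiff i p) b = (\<Sum>a\<in>Poly_Mapping.keys p.
       of_nat (Poly_Mapping.lookup a i) * Poly_Mapping.lookup p a when a - ?e = b)"
      by (simp add: pdiff_def lookup_sum lookup_single)
    also have "\<dots> = (\<Sum>a\<in>Poly_Mapping.keys p.
       of_nat (Poly_Mapping.lookup a i) * Poly_Mapping.lookup p a when a = b + ?e)"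
      by (rule sum.cong) (use iff in \<open>auto simp: when_def\<close>)
    also have "\<dots> = of_nat (Poly_Mapping.lookup b i + 1) * Poly_Mapping.lookup p (b + ?e)"
      by (simp add: when_def lookup_add in_keys_iff)
    finally show ?thesis .
  qed
  have "\<exists>c. c \<noteq> 0 \<and> Const c \<in> I"
    if "\<And>a. a \<in> Poly_Mapping.keys p \<Longrightarrow> (\<Sum>i\<in>UNIV. Poly_Mapping.lookup a i) \<le> n"
       "p \<noteq> 0" "p \<in> I" for n and p :: "'n mpoly"
    using that
  proof (induction n arbitrary: p)
    case 0
    have "a = 0" if "a \<in> Poly_Mapping.keys p" for a
      using 0(1)[OF that] by (intro poly_mapping_eqI) simp
    then have "p = Const (Poly_Mapping.lookup p 0)"
      unfolding Const_def by (intro poly_mapping_eqI) (auto simp: lookup_single when_def in_keys_iff)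
    then show ?case using 0 by (metis Const_0)
  next
    case (Suc n)
    show ?case
    proof (cases "\<exists>i. pdiff i p \<noteq> 0")
      case True
      then obtain i where i: "pdiff i p \<noteq> 0" by blast
      show ?thesis
      proof (rule Suc.IH[OF _ i closed[OF Suc.prems(3)]])
        fix b assume "b \<in> Poly_Mapping.keys (pdiff i p)"
        then have "b + Poly_Mapping.single i 1 \<in> Poly_Mapping.keys p"
          by (auto simp: in_keys_iff lookup_pdiff)
        from Suc.prems(1)[OF this] show "(\<Sum>i\<in>UNIV. Poly_Mapping.lookup b i) \<le> n"
          by (simp add: lookup_add sum.distrib lookup_single when_def)
      qed
    next
      case False
      \<comment> \<open>All partial derivatives of \<open>p\<close> vanish. In characteristic zero
        the integer factor in \<open>lookup_pdiff\<close> is nonzero, so only the constant monomial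
        can occur.\<close>
      have "a = 0" if "a \<in> Poly_Mapping.keys p" for a
      proof (rule poly_mapping_eqI)
        fix i
        show "Poly_Mapping.lookup a i = Poly_Mapping.lookup 0 i"
        proof (rule ccontr)
          assume *: "Poly_Mapping.lookup a i \<noteq> Poly_Mapping.lookup 0 i"
          have "a - Poly_Mapping.single i 1 + Poly_Mapping.single i 1 = a"
            by (rule poly_mapping_eqI)
               (use * in \<open>auto simp: lookup_add lookup_minus lookup_single when_def\<close>)
          then have "Poly_Mapping.lookup (pdiff i p) (a - Poly_Mapping.single i 1) \<noteq> 0"
            using that lookup_pdiff[of i p "a - Poly_Mapping.single i 1"] of_nat_neq_0
            by (auto simp: in_keys_iff simp del: of_nat_Suc)
          then show False using False by simp
        qed
      qed
      then have "p = Const (Poly_Mapping.lookup p 0)"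
        unfolding Const_def by (intro poly_mapping_eqI) (auto simp: lookup_single when_def in_keys_iff)
      then show ?thesis using Suc.prems by (metis Const_0)
    qed
  qed
  \<comment> \<open>The bound supplied for \<open>n\<close> is the total degree of
    \<open>p\<close>.\<close>
  from this[OF _ assms(1,2), of "Max ((\<lambda>a. \<Sum>i\<in>UNIV. Poly_Mapping.lookup a i) ` Poly_Mapping.keys p)"]
  show ?thesis by simp
qed


section \<open>Extension of substitutions to rational functions\<close>

text \<open>Injectivity of the substitution is what allows it to pass to fractions: nonzero
  denominators stay nonzero.\<close>

definition alg_indep :: "('n::{finite,linorder} \<Rightarrow> 'n mpoly) \<Rightarrow> bool" where
  "alg_indep g \<longleftrightarrow> (\<forall>p. subst g p = 0 \<longrightarrow> p = 0)"

lemma subst_eq_0_iff: "alg_indep g \<Longrightarrow> subst g p = 0 \<longleftrightarrow> p = 0"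
  by (auto simp: alg_indep_def)

definition fsubst :: "('n::{finite,linorder} \<Rightarrow> 'n mpoly) \<Rightarrow> 'n ratfun \<Rightarrow> 'n ratfun" where
  "fsubst g x = (THE y. \<exists>a b. b \<noteq> 0 \<and> x = Fract a b \<and> y = Fract (subst g a) (subst g b))"

lemma fsubst_Fract:
  assumes "alg_indep g" "b \<noteq> 0"
  shows "fsubst g (Fract a b) = Fract (subst g a) (subst g b)"
  unfolding fsubst_def
proof (rule the_equality)
  fix y assume "\<exists>c d. d \<noteq> 0 \<and> Fract a b = Fract c d \<and> y = Fract (subst g c) (subst g d)"
  then obtain c d where d: "d \<noteq> 0" "a * d = c * b" and y: "y = Fract (subst g c) (subst g d)"
    using assms by (auto simp: eq_fract)
  from d have "subst g a * subst g d = subst g c * subst g b"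
    by (metis subst_mult)
  moreover have "subst g b \<noteq> 0" "subst g d \<noteq> 0"
    using assms d by (auto simp: subst_eq_0_iff)
  ultimately show "y = Fract (subst g a) (subst g b)"
    by (simp add: y eq_fract)
qed (use assms in blast)

lemma fsubst_to_fract: "alg_indep g \<Longrightarrow> fsubst g (to_fract p) = to_fract (subst g p)"
  by (simp add: to_fract_def fsubst_Fract)

lemma fsubst_add: "alg_indep g \<Longrightarrow> fsubst g (x + y) = fsubst g x + fsubst g y"
  by (cases x; cases y) (auto simp: fsubst_Fract subst_add subst_mult subst_eq_0_iff)

lemma fsubst_mult: "alg_indep g \<Longrightarrow> fsubst g (x * y) = fsubst g x * fsubst g y"
  by (cases x; cases y) (auto simp: fsubst_Fract subst_mult subst_eq_0_iff)

lemma fsubst_0: "alg_indep g \<Longrightarrow> fsubst g 0 = 0"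
  using fsubst_to_fract[of g 0] by simp

lemma fsubst_1: "alg_indep g \<Longrightarrow> fsubst g 1 = 1"
  using fsubst_to_fract[of g 1] by simp

lemma fsubst_sum: "alg_indep g \<Longrightarrow> fsubst g (sum f A) = (\<Sum>a\<in>A. fsubst g (f a))"
  by (induction A rule: infinite_finite_induct) (auto simp: fsubst_add fsubst_0)

lemma fsubst_eq_0_iff: "alg_indep g \<Longrightarrow> fsubst g x = 0 \<longleftrightarrow> x = 0"
  by (cases x) (auto simp: fsubst_Fract eq_fract subst_eq_0_iff Zero_fract_def)

lemma fsubst_divide: "alg_indep g \<Longrightarrow> fsubst g (x / y) = fsubst g x / fsubst g y"
  using fsubst_mult[of g "x / y" y]
  by (cases "y = 0") (auto simp: fsubst_0 fsubst_eq_0_iff field_simps)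

lemma fsubst_inject: "alg_indep g \<Longrightarrow> fsubst g x = fsubst g y \<longleftrightarrow> x = y"
  using fsubst_add[of g "x - y" y] fsubst_eq_0_iff[of g "x - y"] by simp

lemma to_fract_power: "to_fract (p ^ n) = to_fract p ^ n"
  by (induction n) auto

lemma to_fract_sum: "to_fract (sum f A) = (\<Sum>a\<in>A. to_fract (f a))"
  by (induction A rule: infinite_finite_induct) auto

lemma rdiff_divide:
  assumes "y \<noteq> 0"
  shows "rdiff i (x / y) = (rdiff i x * y - x * rdiff i y) / (y * y)"
  using rdiff_mult[of i "x / y" y] assms by (simp add: field_simps)


section \<open>Elementary symmetric polynomials and their derivatives\<close>

text \<open>This is the derivative of \<open>esym (Suc m)\<close> in \<open>X i\<close>, see
  \<open>pdiff_esym_Suc\<close>, hence an entry of the Jacobian matrix of the elementary symmetric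
  polynomials.\<close>

definition esym_except :: "'n::finite \<Rightarrow> nat \<Rightarrow> 'n mpoly" where
  "esym_except i m = (\<Sum>S | card S = m \<and> i \<notin> S. \<Prod>j\<in>S. X j)"

lemma esym_0 [simp]: "esym 0 = 1"
proof -
  have "{S :: 'a set. card S = 0} = {{}}" by auto
  then show ?thesis by (simp add: esym_def)
qed

lemma esym_eq_0: "CARD('n) < m \<Longrightarrow> (esym m :: 'n::finite mpoly) = 0"
proof -
  assume "CARD('n) < m"
  then have "{S :: 'n set. card S = m} = {}"
    using card_mono[of "UNIV :: 'n set"] by (auto simp: not_less[symmetric])
  then show ?thesis by (simp add: esym_def)
qed

lemma esym_except_0 [simp]: "esym_except i 0 = 1"
proof -
  have "{S :: 'a set. card S = 0 \<and> i \<notin> S} = {{}}" by auto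
  then show ?thesis by (simp add: esym_except_def)
qed

lemma X_times_esym_except:
  "X i * esym_except i m = (\<Sum>S | card S = Suc m \<and> i \<in> S. \<Prod>j\<in>S. X j)"
proof -
  have "(\<Sum>S | card S = Suc m \<and> i \<in> S. \<Prod>j\<in>S. X j :: 'a mpoly) =
      (\<Sum>S | card S = m \<and> i \<notin> S. \<Prod>j\<in>insert i S. X j)"
    by (rule sum.reindex_bij_witness[of _ "insert i" "\<lambda>S. S - {i}"])
       (auto simp: insert_absorb)
  also have "\<dots> = X i * esym_except i m"
    unfolding esym_except_def sum_distrib_left by (rule sum.cong) auto
  finally show ?thesis ..
qed

text \<open>The subsets of size \<open>Suc m\<close> are split according to whether they contain
  \<open>i\<close>.\<close>

lemma esym_Suc: "esym (Suc m) = esym_except i (Suc m) + X i * esym_except i m"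
proof -
  have "{S. card S = Suc m} = {S. card S = Suc m \<and> i \<notin> S} \<union> {S. card S = Suc m \<and> i \<in> S}"
    by auto
  then show ?thesis
    unfolding X_times_esym_except unfolding esym_def esym_except_def
    by (simp only:) (rule sum.union_disjoint, auto)
qed

lemma pdiff_esym_except [simp]: "pdiff i (esym_except i m) = 0"
proof -
  have "pdiff i (prod X S) = 0" if "i \<notin> S" for S
    using that by (simp add: pdiff_prod pdiff_X cong: sum.cong)
       (rule sum.neutral, auto)
  then show ?thesis by (simp add: esym_except_def pdiff_sum)
qed

lemma pdiff_esym_Suc: "pdiff i (esym (Suc m)) = esym_except i m"
  by (subst esym_Suc[of m i]) (simp add: pdiff_add pdiff_mult pdiff_X)

text \<open>Each set of size \<open>Suc m\<close> is counted once for each of its elements. This is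
  Euler's identity for a homogeneous polynomial, and the source of Newton's identities
  below.\<close>

lemma sum_X_times_esym_except:
  "(\<Sum>i\<in>UNIV. X i * esym_except i m) = of_nat (Suc m) * esym (Suc m)"
proof -
  have "(\<Sum>i\<in>UNIV. X i * esym_except i m) =
      (\<Sum>i\<in>UNIV. \<Sum>S\<in>{S. card S = Suc m}. if i \<in> S then prod X S else 0)"
    unfolding X_times_esym_except by (rule sum.cong) (simp_all flip: sum.inter_filter)
  also have "\<dots> = (\<Sum>S | card S = Suc m. \<Sum>i\<in>UNIV. if i \<in> S then prod X S else 0)"
    by (rule sum.swap)
  also have "\<dots> = (\<Sum>S | card S = Suc m. of_nat (Suc m) * prod X S)"
    by (rule sum.cong) (auto simp: sum.If_cases)
  finally show ?thesis by (simp add: esym_def sum_distrib_left)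
qed

text \<open>This unrolls the recurrence obtained by solving \<open>esym_Suc\<close> for
  \<open>esym_except i (Suc m)\<close>.\<close>

lemma esym_except_conv_esym:
  "esym_except i m = (\<Sum>r\<le>m. (- X i) ^ r * esym (m - r))"
proof (induction m)
  case (Suc m)
  have "esym_except i (Suc m) = esym (Suc m) - X i * esym_except i m"
    by (simp add: esym_Suc[of m i])
  then show ?case
    unfolding Suc
    by (simp add: sum.atMost_Suc_shift sum_distrib_left sum_negf mult.assoc del: sum.atMost_Suc)
qed simp

text \<open>The product is expanded over the sets \<open>S\<close> of factors that contribute
  \<open>- X l\<close>, and these sets are grouped by size. With \<open>x\<close> a variable this
  evaluates the rows of the Jacobian matrix against powers of that variable.\<close>

lemma vieta_except:
  "(\<Prod>l\<in>-{i}. x - X l) =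
    (\<Sum>m<CARD('n). (-1) ^ m * esym_except i m * x ^ (CARD('n) - Suc m))"
  for i :: "'n::finite"
proof -
  have card: "card (-{i}) = CARD('n) - 1" by (simp add: Compl_eq_Diff_UNIV)
  have "(\<Prod>l\<in>-{i}. x - X l) = (\<Prod>l\<in>-{i}. - X l + x)" by simp
  also have "\<dots> = (\<Sum>S\<in>Pow (-{i}). (\<Prod>l\<in>S. - X l) * x ^ card (-{i} - S))"
    by (subst prod_add) auto
  also have "\<dots> = (\<Sum>S\<in>Pow (-{i}). (-1) ^ card S * prod X S * x ^ (CARD('n) - Suc (card S)))"
  proof (rule sum.cong)
    fix S assume "S \<in> Pow (-{i})"
    then have "card (-{i} - S) = CARD('n) - Suc (card S)"
      using card by (subst card_Diff_subset) (auto intro: finite_subset)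
    moreover have "(\<Prod>l\<in>S. - X l) = (-1) ^ card S * prod X S"
      by (simp add: prod_uminus)
    ultimately show "(\<Prod>l\<in>S. - X l) * x ^ card (-{i} - S) =
      (-1) ^ card S * prod X S * x ^ (CARD('n) - Suc (card S))" by simp
  qed simp
  also have "\<dots> = (\<Sum>m<CARD('n). \<Sum>S\<in>{S \<in> Pow (-{i}). card S = m}.
      (-1) ^ card S * prod X S * x ^ (CARD('n) - Suc (card S)))"
  proof (rule sum.group[symmetric])
    show "card ` Pow (-{i}) \<subseteq> {..<CARD('n)}"
    proof
      fix m assume "m \<in> card ` Pow (-{i})"
      then obtain S where "S \<subseteq> -{i}" "m = card S" by auto
      then have "m \<le> CARD('n) - 1" using card_mono[of "-{i}" S] card by auto
      then show "m \<in> {..<CARD('n)}" by (simp add: Suc_le_eq order_le_less_trans)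
    qed
  qed auto
  also have "\<dots> = (\<Sum>m<CARD('n). (-1) ^ m * esym_except i m * x ^ (CARD('n) - Suc m))"
  proof (rule sum.cong)
    fix m
    have "{S \<in> Pow (-{i}). card S = m} = {S. card S = m \<and> i \<notin> S}" by auto
    then show "(\<Sum>S\<in>{S \<in> Pow (-{i}). card S = m}.
        (-1) ^ card S * prod X S * x ^ (CARD('n) - Suc (card S))) =
      (-1) ^ m * esym_except i m * x ^ (CARD('n) - Suc m)"
      by (simp add: esym_except_def sum_distrib_left sum_distrib_right)
  qed simp
  finally show ?thesis .
qed

lemma bij_betw_rank: "bij_betw rank (UNIV :: 'n::{finite,linorder} set) {1..CARD('n)}"
proof -
  have less: "rank i < rank j" if "i < j" for i j :: 'n
    unfolding rank_def
  proof (rule psubset_card_mono)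
    have "j \<notin> {l. l \<le> i}" using that by simp
    then show "{l. l \<le> i} \<subset> {l. l \<le> j}" using that by auto
  qed simp
  then have "inj (rank :: 'n \<Rightarrow> nat)"
    by (intro linorder_injI) force
  moreover have "rank i \<in> {1..CARD('n)}" for i :: 'n
    using card_mono[of UNIV "{j. j \<le> i}"] card_gt_0_iff[of "{j. j \<le> i}"]
    by (auto simp: rank_def Suc_le_eq)
  ultimately show ?thesis
    unfolding bij_betw_def
    by (intro conjI card_subset_eq) (auto simp: card_image)
qed

lemma sum_rank: "(\<Sum>j\<in>(UNIV :: 'n::{finite,linorder} set). F (rank j)) = (\<Sum>m<CARD('n). F (Suc m))"
proof -
  have "(\<Sum>j\<in>(UNIV :: 'n set). F (rank j)) = sum F {1..CARD('n)}"
    by (rule sum.reindex_bij_betw[OF bij_betw_rank])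
  also have "\<dots> = (\<Sum>m<CARD('n). F (Suc m))"
    by (rule sum.reindex_bij_witness[of _ Suc "\<lambda>m. m - 1"]) auto
  finally show ?thesis .
qed


section \<open>Derivations along the elementary symmetric polynomials\<close>

definition diffprod :: "'n::finite \<Rightarrow> 'n mpoly" where
  "diffprod i = (\<Prod>l\<in>-{i}. X i - X l)"

lemma diffprod_nonzero: "diffprod (i :: 'n::{finite,linorder}) \<noteq> 0"
  by (auto simp: diffprod_def X_inject)

text \<open>The value of \<open>inv_jac j i\<close> is \<open>\<partial>z\<^sub>i/\<partial>\<sigma>\<^sub>j\<close>, found by differentiating
  \<open>\<Sum>\<^sub>m (-1)\<^sup>m \<sigma>\<^sub>m z\<^sub>i\<^bsup>k-m\<^esup> = 0\<close>.\<close>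

definition inv_jac :: "'n::{finite,linorder} \<Rightarrow> 'n \<Rightarrow> 'n ratfun" where
  "inv_jac j i = to_fract ((-1) ^ (rank j - 1) * X i ^ (CARD('n) - rank j)) / to_fract (diffprod i)"

text \<open>By \<open>vieta_except\<close> the numerator is the product of \<open>X l - X s\<close>
  over all \<open>s\<close> different from \<open>i\<close>. For \<open>i\<close> different from
  \<open>l\<close> the factor with \<open>s = l\<close> vanishes; otherwise the product is
  \<open>diffprod l\<close>.\<close>

lemma jac_inv_jac:
  "(\<Sum>j\<in>UNIV. to_fract (pdiff i (esym (rank j))) * inv_jac j l) = (if i = l then 1 else 0)"
  for i l :: "'n::{finite,linorder}"
proof -
  have "(\<Sum>j\<in>UNIV. to_fract (pdiff i (esym (rank j))) * inv_jac j l) =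
      to_fract (\<Sum>j\<in>(UNIV :: 'n set). (-1) ^ (rank j - 1) * pdiff i (esym (rank j)) * X l ^ (CARD('n) - rank j))
        / to_fract (diffprod l)"
    by (simp add: inv_jac_def to_fract_sum sum_divide_distrib mult_ac)
  also have "(\<Sum>j\<in>(UNIV :: 'n set). (-1) ^ (rank j - 1) * pdiff i (esym (rank j)) * X l ^ (CARD('n) - rank j))
      = (\<Prod>s\<in>-{i}. X l - X s)"
    unfolding vieta_except
    by (subst sum_rank[of "\<lambda>r. (-1) ^ (r - 1) * pdiff i (esym r) * X l ^ (CARD('n) - r)"])
       (simp add: pdiff_esym_Suc)
  also have "\<dots> = (if i = l then diffprod l else 0)"
    by (auto simp: diffprod_def)
  finally show ?thesis by (simp add: diffprod_nonzero)
qed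

text \<open>A one-sided inverse of a square matrix over a field is two-sided, so
  \<open>jac_inv_jac\<close> can be read in the other order.\<close>

lemma inv_jac_jac:
  "(\<Sum>i\<in>UNIV. inv_jac j i * to_fract (pdiff i (esym (rank l)))) = (if j = l then 1 else 0)"
  for j l :: "'n::{finite,linorder}"
proof -
  define M :: "(('n ratfun, 'n) vec, 'n) vec" where "M = (\<chi> i j. to_fract (pdiff i (esym (Defs.rank j))))"
  define N :: "(('n ratfun, 'n) vec, 'n) vec" where "N = (\<chi> j i. inv_jac j i)"
  have "M ** N = mat 1"
    by (simp add: M_def N_def matrix_matrix_mult_def mat_def jac_inv_jac)
  then have "N ** M = mat 1"
    by (simp add: matrix_left_right_inverse)
  then have "(N ** M) $ j $ l = mat 1 $ j $ l" by simp
  then show ?thesis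
    by (simp add: M_def N_def matrix_matrix_mult_def mat_def)
qed

text \<open>The chain rule for the derivative along the \<open>j\<close>-th elementary symmetric
  polynomial, as a derivation of the rational functions in the original variables.\<close>

definition sdiff :: "'n::{finite,linorder} \<Rightarrow> 'n ratfun \<Rightarrow> 'n ratfun" where
  "sdiff j x = (\<Sum>i\<in>UNIV. inv_jac j i * rdiff i x)"

lemma sdiff_add: "sdiff j (x + y) = sdiff j x + sdiff j y"
  by (simp add: sdiff_def rdiff_add ring_distribs sum.distrib)

lemma sdiff_mult: "sdiff j (x * y) = sdiff j x * y + x * sdiff j y"
  by (simp add: sdiff_def rdiff_mult ring_distribs sum.distrib sum_distrib_left sum_distrib_right mult_ac)

text \<open>The chain rule in the opposite direction. Here the coefficients are polynomials, which
  is what later makes \<open>lift_span\<close> stable under \<open>rdiff\<close>.\<close>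

lemma rdiff_conv_sdiff:
  "rdiff i x = (\<Sum>j\<in>UNIV. to_fract (pdiff i (esym (rank j))) * sdiff j x)"
proof -
  have "(\<Sum>j\<in>UNIV. to_fract (pdiff i (esym (rank j))) * sdiff j x) =
      (\<Sum>j\<in>UNIV. \<Sum>l\<in>UNIV. to_fract (pdiff i (esym (rank j))) * inv_jac j l * rdiff l x)"
    by (simp add: sdiff_def sum_distrib_left mult.assoc)
  also have "\<dots> = (\<Sum>l\<in>UNIV. \<Sum>j\<in>UNIV. to_fract (pdiff i (esym (rank j))) * inv_jac j l * rdiff l x)"
    by (rule sum.swap)
  also have "\<dots> = (\<Sum>l\<in>UNIV. (if i = l then 1 else 0) * rdiff l x)"
    by (simp only: sum_distrib_right[symmetric] jac_inv_jac)
  also have "\<dots> = (\<Sum>l\<in>UNIV. if i = l then rdiff l x else 0)"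
    by (rule sum.cong) auto
  finally show ?thesis by simp
qed

text \<open>Both sides obey the same Leibniz rule along \<open>esym_subst\<close>, and on variables
  they agree by \<open>inv_jac_jac\<close>.\<close>

lemma sdiff_esym_subst: "sdiff j (to_fract (esym_subst p)) = to_fract (esym_subst (pdiff j p))"
proof (induction p rule: mpoly_induct)
  case (X i)
  show ?case
    using inv_jac_jac[of j i] by (auto simp: esym_subst_def sdiff_def rdiff_to_fract pdiff_X)
next
  case (mult p q)
  then show ?case
    by (simp add: esym_subst_def subst_mult subst_add pdiff_mult sdiff_mult)
next
  case (add p q)
  then show ?case
    by (simp add: esym_subst_def subst_add pdiff_add sdiff_add)
qed (simp add: esym_subst_def sdiff_def rdiff_to_fract)

text \<open>The kernel of \<open>esym_subst\<close> is closed under differentiation, so it contains no nonzero polynomial.\<close>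

lemma alg_indep_esym: "alg_indep (\<lambda>i :: 'n::{finite,linorder}. esym (rank i))"
  unfolding alg_indep_def esym_subst_def[symmetric]
proof (intro allI impI, rule ccontr)
  fix p :: "'n mpoly"
  assume "esym_subst p = 0" "p \<noteq> 0"
  moreover have "esym_subst (pdiff i q) = 0" if "esym_subst q = 0" for i and q :: "'n mpoly"
    using sdiff_esym_subst[of i q] that by (simp add: sdiff_def)
  ultimately have "\<exists>c. c \<noteq> 0 \<and> (Const c :: 'n mpoly) \<in> {p. esym_subst p = 0}"
    by (intro const_in_deriv_closed[of p]) auto
  then show False by (auto simp: esym_subst_def Const_eq_0_iff)
qed

definition esym_fsubst :: "'n::{finite,linorder} ratfun \<Rightarrow> 'n ratfun" where
  "esym_fsubst = fsubst (\<lambda>i. esym (rank i))"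

lemma esym_fsubst_to_fract: "esym_fsubst (to_fract p) = to_fract (esym_subst p)"
  by (simp add: esym_fsubst_def esym_subst_def fsubst_to_fract alg_indep_esym)

lemmas esym_fsubst_add = fsubst_add[OF alg_indep_esym, folded esym_fsubst_def]
lemmas esym_fsubst_mult = fsubst_mult[OF alg_indep_esym, folded esym_fsubst_def]
lemmas esym_fsubst_0 = fsubst_0[OF alg_indep_esym, folded esym_fsubst_def]
lemmas esym_fsubst_1 = fsubst_1[OF alg_indep_esym, folded esym_fsubst_def]
lemmas esym_fsubst_divide = fsubst_divide[OF alg_indep_esym, folded esym_fsubst_def]
lemmas esym_fsubst_eq_0_iff = fsubst_eq_0_iff[OF alg_indep_esym, folded esym_fsubst_def]
lemmas esym_fsubst_inject = fsubst_inject[OF alg_indep_esym, folded esym_fsubst_def]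

lemma esym_subst_inject: "esym_subst p = esym_subst q \<longleftrightarrow> p = q"
  using esym_fsubst_inject[of "to_fract p" "to_fract q"] by (simp add: esym_fsubst_to_fract)

text \<open>The polynomial case is applied to numerator and denominator; the Leibniz rule for
  \<open>x * ?b = ?a\<close> then determines the derivative of the quotient.\<close>

lemma sdiff_esym_fsubst: "sdiff j (esym_fsubst x) = esym_fsubst (rdiff j x)"
proof -
  obtain a b where x: "x = Fract a b" "b \<noteq> 0" by (cases x) auto
  let ?a = "to_fract a" and ?b = "to_fract b" and ?\<phi> = esym_fsubst
  have xb: "x * ?b = ?a" using x by (simp add: to_fract_def eq_fract)
  have "sdiff j (?\<phi> x) * ?\<phi> ?b + ?\<phi> x * ?\<phi> (rdiff j ?b) = sdiff j (?\<phi> (x * ?b))"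
    by (simp add: esym_fsubst_mult sdiff_mult)
       (simp add: esym_fsubst_to_fract sdiff_esym_subst rdiff_to_fract)
  also have "\<dots> = ?\<phi> (rdiff j (x * ?b))"
    unfolding xb by (simp add: esym_fsubst_to_fract sdiff_esym_subst rdiff_to_fract)
  also have "\<dots> = ?\<phi> (rdiff j x) * ?\<phi> ?b + ?\<phi> x * ?\<phi> (rdiff j ?b)"
    by (simp add: rdiff_mult esym_fsubst_mult esym_fsubst_add)
  finally show ?thesis
    using x by (simp add: esym_fsubst_eq_0_iff)
qed


section \<open>Permutations of the variables and symmetric polynomials\<close>

abbreviation perm_subst :: "('n \<Rightarrow> 'n) \<Rightarrow> 'n::{finite,linorder} mpoly \<Rightarrow> 'n mpoly" where
  "perm_subst w \<equiv> subst (\<lambda>i. X (w i))"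

abbreviation perm_fsubst :: "('n \<Rightarrow> 'n) \<Rightarrow> 'n::{finite,linorder} ratfun \<Rightarrow> 'n ratfun" where
  "perm_fsubst w \<equiv> fsubst (\<lambda>i. X (w i))"

lemma perm_subst_inv:
  assumes "bij w"
  shows "perm_subst (inv_into UNIV w) (perm_subst w p) = p" "perm_subst w (perm_subst (inv_into UNIV w) p) = p"
  using assms by (simp_all add: subst_subst bij_is_inj bij_is_surj surj_f_inv_f subst_X_id)

lemma alg_indep_perm: "bij w \<Longrightarrow> alg_indep (\<lambda>i. X (w i))"
  unfolding alg_indep_def using perm_subst_inv(1) by (metis subst_0)

lemma perm_subst_esym: "bij w \<Longrightarrow> perm_subst w (esym m) = esym m"
proof -
  assume w: "bij w"
  have "perm_subst w (esym m) = (\<Sum>S | card S = m. \<Prod>i\<in>w ` S. X i)"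
    using w by (simp add: esym_def subst_sum subst_prod prod.reindex inj_on_subset[OF bij_is_inj])
  also have "\<dots> = esym m"
    unfolding esym_def
    by (rule sum.reindex_bij_witness[of _ "\<lambda>S. inv_into UNIV w ` S" "\<lambda>S. w ` S"])
       (use w in \<open>auto simp: image_image bij_is_surj surj_f_inv_f bij_is_inj card_image
          inj_on_subset[OF bij_is_inj] inj_on_subset[OF bij_is_inj[OF bij_imp_bij_inv]]\<close>)
  finally show ?thesis .
qed

lemma perm_subst_esym_subst: "bij w \<Longrightarrow> perm_subst w (esym_subst p) = esym_subst p"
  by (simp add: esym_subst_def subst_subst perm_subst_esym)

lemma perm_subst_pdiff:
  assumes "bij w"
  shows "perm_subst w (pdiff i p) = pdiff (w i) (perm_subst w p)"
proof (induction p rule: mpoly_induct)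
  case (X j)
  have "w i = w j \<longleftrightarrow> i = j" using assms by (simp add: bij_is_inj inj_eq)
  then show ?case by (simp add: pdiff_X)
qed (simp_all add: subst_add subst_mult pdiff_add pdiff_mult)

lemma perm_fsubst_rdiff:
  assumes "bij w"
  shows "perm_fsubst w (rdiff i x) = rdiff (w i) (perm_fsubst w x)"
proof -
  obtain a b where "x = Fract a b" "b \<noteq> 0" by (cases x) auto
  then show ?thesis
    using assms by (simp add: rdiff_Fract fsubst_Fract alg_indep_perm subst_eq_0_iff
        subst_diff subst_mult perm_subst_pdiff)
qed

lemma perm_subst_diffprod:
  assumes "bij w"
  shows "perm_subst w (diffprod i) = diffprod (w i)"
proof -
  have "perm_subst w (diffprod i) = (\<Prod>l\<in>-{i}. X (w i) - X (w l))"
    by (simp add: diffprod_def subst_prod subst_diff)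
  also have "\<dots> = diffprod (w i)"
    unfolding diffprod_def
    by (rule prod.reindex_bij_witness[of _ "inv_into UNIV w" w])
       (use assms in \<open>auto simp: bij_is_surj surj_f_inv_f bij_is_inj bij_inv_eq_iff inj_eq\<close>)
  finally show ?thesis .
qed

text \<open>A permutation carries \<open>inv_jac j i\<close> to \<open>inv_jac j (w i)\<close> and
  \<open>rdiff i\<close> to \<open>rdiff (w i)\<close>, so it only reorders the sum defining
  \<open>sdiff\<close>.\<close>

lemma perm_fsubst_sdiff:
  assumes w: "bij w"
  shows "perm_fsubst w (sdiff j x) = sdiff j (perm_fsubst w x)"
proof -
  have "perm_fsubst w (inv_jac j i) = inv_jac j (w i)" for i
    using w by (simp add: inv_jac_def fsubst_divide fsubst_mult fsubst_to_fract alg_indep_perm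
        perm_subst_diffprod subst_mult subst_power subst_uminus)
  then have "perm_fsubst w (sdiff j x) = (\<Sum>i\<in>UNIV. inv_jac j (w i) * rdiff (w i) (perm_fsubst w x))"
    using w by (simp add: sdiff_def fsubst_sum fsubst_mult alg_indep_perm perm_fsubst_rdiff)
  also have "\<dots> = sdiff j (perm_fsubst w x)"
    unfolding sdiff_def
    by (rule sum.reindex_bij_betw[OF w, of "\<lambda>i. inv_jac j i * rdiff i (perm_fsubst w x)"])
  finally show ?thesis .
qed

section \<open>Newton's identities and the fundamental theorem of symmetric polynomials\<close>

lemma range_esym_subst_closed:
  "Const c \<in> range esym_subst" "0 \<in> range esym_subst" "1 \<in> range esym_subst"
  "p \<in> range esym_subst \<Longrightarrow> q \<in> range esym_subst \<Longrightarrow> p + q \<in> range esym_subst"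
  "p \<in> range esym_subst \<Longrightarrow> q \<in> range esym_subst \<Longrightarrow> p - q \<in> range esym_subst"
  "p \<in> range esym_subst \<Longrightarrow> q \<in> range esym_subst \<Longrightarrow> p * q \<in> range esym_subst"
proof -
  show c: "Const c \<in> range esym_subst" for c
    by (metis esym_subst_def subst_Const rangeI)
  show "0 \<in> range esym_subst" "1 \<in> range esym_subst"
    using c[of 0] c[of 1] by simp_all
  show "p \<in> range esym_subst \<Longrightarrow> q \<in> range esym_subst \<Longrightarrow> p + q \<in> range esym_subst"
    by (metis (no_types, lifting) esym_subst_def subst_add imageE rangeI)
  show "p \<in> range esym_subst \<Longrightarrow> q \<in> range esym_subst \<Longrightarrow> p - q \<in> range esym_subst"
    by (metis (no_types, lifting) esym_subst_def subst_diff imageE rangeI)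
  show "p \<in> range esym_subst \<Longrightarrow> q \<in> range esym_subst \<Longrightarrow> p * q \<in> range esym_subst"
    by (metis (no_types, lifting) esym_subst_def subst_mult imageE rangeI)
qed

lemma range_esym_subst_sum:
  "(\<And>a. a \<in> A \<Longrightarrow> f a \<in> range esym_subst) \<Longrightarrow> sum f A \<in> range esym_subst"
  by (induction A rule: infinite_finite_induct) (auto intro: range_esym_subst_closed)

lemma esym_in_range: "esym m \<in> range (esym_subst :: 'n::{finite,linorder} mpoly \<Rightarrow> 'n mpoly)"
proof (cases "m = 0 \<or> CARD('n) < m")
  case True
  then show ?thesis using range_esym_subst_closed by (auto simp: esym_eq_0)
next
  case False
  then have "m \<in> rank ` (UNIV :: 'n set)"
    using bij_betw_rank[where 'n = 'n] by (auto simp: bij_betw_def)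
  then obtain i :: 'n where "m = rank i" by blast
  then have "esym m = esym_subst (X i)" by (simp add: esym_subst_def)
  then show ?thesis by blast
qed

text \<open>Newton's identities express the power sum of degree \<open>Suc n\<close> through
  elementary symmetric polynomials and the power sums of lower positive degree.\<close>

lemma power_sum_in_range:
  "(\<Sum>i\<in>UNIV. X i ^ m) \<in> range (esym_subst :: 'n::{finite,linorder} mpoly \<Rightarrow> 'n mpoly)"
proof (induction m rule: less_induct)
  case (less m)
  let ?R = "range (esym_subst :: 'n mpoly \<Rightarrow> 'n mpoly)"
  define P :: "nat \<Rightarrow> 'n mpoly" where "P m = (\<Sum>i\<in>UNIV. X i ^ m)" for m
  show ?case
  proof (cases m)
    case 0
    then show ?thesis using range_esym_subst_closed(1)[of "of_nat CARD('n)"]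
      by (simp add: Const_of_nat)
  next
    case (Suc n)
    have "of_nat (Suc n) * esym (Suc n) = (\<Sum>i\<in>(UNIV :: 'n set). X i * esym_except i n)"
      by (rule sum_X_times_esym_except[symmetric])
    also have "\<dots> = (\<Sum>i\<in>(UNIV :: 'n set). \<Sum>r\<le>n. (-1) ^ r * X i ^ Suc r * esym (n - r))"
      unfolding esym_except_conv_esym sum_distrib_left
      by (intro sum.cong refl) (simp add: power_minus[of "X _"] mult_ac)
    also have "\<dots> = (\<Sum>r\<le>n. \<Sum>i\<in>(UNIV :: 'n set). (-1) ^ r * X i ^ Suc r * esym (n - r))"
      by (rule sum.swap)
    also have "\<dots> = (\<Sum>r\<le>n. (-1) ^ r * P (Suc r) * esym (n - r))"
      unfolding P_def sum_distrib_left sum_distrib_right ..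
    also have "\<dots> = (\<Sum>r<n. (-1) ^ r * P (Suc r) * esym (n - r)) + (-1) ^ n * P (Suc n)"
      unfolding lessThan_Suc_atMost[symmetric] by simp
    finally have "(-1) ^ n * P (Suc n) =
        of_nat (Suc n) * esym (Suc n) - (\<Sum>r<n. (-1) ^ r * P (Suc r) * esym (n - r))"
      by simp
    \<comment> \<open>The sign is its own inverse, so a second multiplication by it isolates the
      power sum.\<close>
    then have "(-1) ^ n * ((-1) ^ n * P (Suc n)) = (-1) ^ n *
        (of_nat (Suc n) * esym (Suc n) - (\<Sum>r<n. (-1) ^ r * P (Suc r) * esym (n - r)))"
      by (rule arg_cong)
    then have eq: "P m = (-1) ^ n *
        (of_nat (Suc n) * esym (Suc n) - (\<Sum>r<n. (-1) ^ r * P (Suc r) * esym (n - r)))"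
      by (simp add: Suc mult.assoc[symmetric] flip: power_mult_distrib)
    have sign: "(-1) ^ r \<in> ?R" for r :: nat
      using range_esym_subst_closed(1)[of "(-1) ^ r"]
      by (cases "even r") (simp_all add: Const_def single_uminus)
    have of_nat: "of_nat r \<in> ?R" for r :: nat
      using range_esym_subst_closed(1)[of "of_nat r"] by (simp add: Const_of_nat)
    have "P m \<in> ?R"
      unfolding eq
      by (intro range_esym_subst_closed range_esym_subst_sum sign of_nat esym_in_range)
         (use less.IH Suc in \<open>auto simp: P_def simp del: power_Suc\<close>)
    then show ?thesis by (simp add: P_def)
  qed
qed

text \<open>Induction on \<open>S\<close>: multiplying the sum for \<open>S\<close> by a power sum gives the sum for
  \<open>insert s S\<close> plus sums for \<open>S\<close>.\<close>

lemma injective_sum_in_range: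
  fixes a :: "'n::{finite,linorder} \<Rightarrow> nat" and S :: "'n set"
  shows "(\<Sum>w | w \<in> extensional S \<and> inj_on w S. \<Prod>s\<in>S. X (w s) ^ a s)
    \<in> range (esym_subst :: 'n mpoly \<Rightarrow> 'n mpoly)"
proof (induction S arbitrary: a rule: finite_induct[OF finite])
  case 1
  \<comment> \<open>Extensionality makes the empty set carry exactly one map, so the sum is
    \<open>1\<close>.\<close>
  have "{w :: 'n \<Rightarrow> 'n. w \<in> extensional {} \<and> inj_on w {}} = {\<lambda>_. undefined}" by auto
  then show ?case using range_esym_subst_closed(3) by simp
next
  case (2 x S)
  let ?R = "range (esym_subst :: 'n mpoly \<Rightarrow> 'n mpoly)"
  let ?E = "\<lambda>S. {w :: 'n \<Rightarrow> 'n. w \<in> extensional S \<and> inj_on w S}"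
  define m where "m a w = (\<Prod>s\<in>S. X (w s) ^ a s :: 'n mpoly)" for a w
  \<comment> \<open>An injective map on \<open>insert x S\<close> is an injective map on
    \<open>S\<close> together with a value at \<open>x\<close> outside its image.\<close>
  have "(\<Sum>w\<in>?E (insert x S). \<Prod>s\<in>insert x S. X (w s) ^ a s) =
      (\<Sum>(w, i)\<in>Sigma (?E S) (\<lambda>w. - w ` S). m a w * X i ^ a x)"
  proof (rule sum.reindex_bij_witness[of _ "\<lambda>(w, i). w(x := i)" "\<lambda>w. (restrict w S, w x)"])
    fix w assume w: "w \<in> ?E (insert x S)"
    have "(restrict w S)(x := w x) = w"
      using w by (intro ext) (auto simp: extensional_def restrict_def)
    then show "(case (restrict w S, w x) of (w, i) \<Rightarrow> w(x := i)) = w" by simp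
    have "inj_on (restrict w S) S" using w by (auto simp: inj_on_def)
    then show "(restrict w S, w x) \<in> Sigma (?E S) (\<lambda>w. - w ` S)"
      using w 2(2) by (auto simp: inj_on_def)
    show "(case (restrict w S, w x) of (w, i) \<Rightarrow> m a w * X i ^ a x) =
        (\<Prod>s\<in>insert x S. X (w s) ^ a s)"
      using 2 by (simp add: m_def mult.commute)
  next
    fix p assume p: "p \<in> Sigma (?E S) (\<lambda>w. - w ` S)"
    then obtain w i where wi: "p = (w, i)" "w \<in> extensional S" "inj_on w S" "i \<notin> w ` S" by auto
    have "restrict (w(x := i)) S = w"
      using wi 2(2) by (intro ext) (auto simp: extensional_def restrict_def)
    then show "(restrict (case p of (w, i) \<Rightarrow> w(x := i)) S, (case p of (w, i) \<Rightarrow> w(x := i)) x) = p"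
      using wi by simp
    have "inj_on (w(x := i)) (insert x S)"
      using wi 2(2) by (auto simp: inj_on_def)
    then show "(case p of (w, i) \<Rightarrow> w(x := i)) \<in> ?E (insert x S)"
      using wi by (auto simp: extensional_def)
  qed
  also have "\<dots> = (\<Sum>w\<in>?E S. \<Sum>i\<in>- w ` S. m a w * X i ^ a x)"
    by (subst sum.Sigma) auto
  also have "\<dots> = (\<Sum>w\<in>?E S. m a w * (\<Sum>i\<in>UNIV. X i ^ a x) - (\<Sum>s\<in>S. m (a(s := a s + a x)) w))"
  proof (rule sum.cong)
    fix w assume w: "w \<in> ?E S"
    have "(\<Sum>i\<in>UNIV. X i ^ a x) = (\<Sum>i\<in>- w ` S. X i ^ a x) + (\<Sum>i\<in>w ` S. X i ^ a x :: 'n mpoly)"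
      using sum.union_disjoint[of "- w ` S" "w ` S" "\<lambda>i. X i ^ a x :: 'n mpoly"] by simp
    also have "(\<Sum>i\<in>w ` S. X i ^ a x :: 'n mpoly) = (\<Sum>s\<in>S. X (w s) ^ a x)"
      using w by (simp add: sum.reindex)
    finally have "m a w * (\<Sum>i\<in>UNIV. X i ^ a x) =
        (\<Sum>i\<in>- w ` S. m a w * X i ^ a x) + (\<Sum>s\<in>S. m a w * X (w s) ^ a x)"
      by (simp add: ring_distribs sum_distrib_left)
    \<comment> \<open>The variable \<open>X (w s)\<close> already occurs with exponent
      \<open>a s\<close>, so the extra factor only raises that exponent.\<close>
    moreover have "m a w * X (w s) ^ a x = m (a(s := a s + a x)) w" if "s \<in> S" for s
    proof -
      have "(\<Prod>t\<in>S - {s}. X (w t) ^ (a(s := a s + a x)) t :: 'n mpoly) = (\<Prod>t\<in>S - {s}. X (w t) ^ a t)"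
        by (rule prod.cong) auto
      then show ?thesis
        using that 2(1) by (simp add: m_def prod.remove[of S s] power_add mult_ac)
    qed
    ultimately show "(\<Sum>i\<in>- w ` S. m a w * X i ^ a x) =
        m a w * (\<Sum>i\<in>UNIV. X i ^ a x) - (\<Sum>s\<in>S. m (a(s := a s + a x)) w)"
      by (simp add: algebra_simps)
  qed simp
  also have "\<dots> = (\<Sum>w\<in>?E S. m a w) * (\<Sum>i\<in>UNIV. X i ^ a x) - (\<Sum>s\<in>S. \<Sum>w\<in>?E S. m (a(s := a s + a x)) w)"
    by (simp add: sum_subtractf sum_distrib_right sum.swap[of _ S])
  also have "\<dots> \<in> ?R"
    unfolding m_def by (intro range_esym_subst_closed range_esym_subst_sum power_sum_in_range 2(3))
  finally show ?case .
qed

text \<open>On the finite index type the permutations are the injective maps on \<open>UNIV\<close>,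
  so each monomial of \<open>p\<close> contributes an instance of
  \<open>injective_sum_in_range\<close>.\<close>

lemma perm_average_in_range: "(\<Sum>w | bij w. perm_subst w p) \<in> range esym_subst"
proof -
  have eq: "{w :: 'a \<Rightarrow> 'a. bij w} = {w. w \<in> extensional UNIV \<and> inj_on w UNIV}"
    by (auto simp: bij_def finite_UNIV_inj_surj)
  have "(\<Sum>w | bij w. perm_subst w p) = (\<Sum>a\<in>Poly_Mapping.keys p. \<Sum>w | bij w.
      Const (Poly_Mapping.lookup p a) * (\<Prod>i\<in>UNIV. X (w i) ^ Poly_Mapping.lookup a i))"
    unfolding subst_def by (rule sum.swap)
  also have "\<dots> = (\<Sum>a\<in>Poly_Mapping.keys p. Const (Poly_Mapping.lookup p a) *
      (\<Sum>w | w \<in> extensional UNIV \<and> inj_on w UNIV. \<Prod>i\<in>UNIV. X (w i) ^ Poly_Mapping.lookup a i))"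
    unfolding eq sum_distrib_left ..
  also have "\<dots> \<in> range esym_subst"
    by (intro range_esym_subst_closed range_esym_subst_sum injective_sum_in_range)
  finally show ?thesis .
qed

lemma Const_inverse_card_perms:
  "Const (1 / of_nat (card {w :: 'n::finite \<Rightarrow> 'n. bij w})) * of_nat (card {w :: 'n \<Rightarrow> 'n. bij w})
    = (1 :: 'm mpoly)"
proof -
  have "card {w :: 'n \<Rightarrow> 'n. bij w} \<noteq> 0"
    by (auto intro!: exI[of _ id])
  then show ?thesis
    by (simp add: Const_mult[symmetric] Const_of_nat[symmetric])
qed

text \<open>A symmetric polynomial is its own average over the permutations, and averages lie in the
  range.\<close>

lemma symmetric_in_range:
  assumes "\<And>w. bij w \<Longrightarrow> perm_subst w p = p"
  shows "p \<in> range esym_subst"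
proof -
  define N where "N = card {w :: 'a \<Rightarrow> 'a. bij w}"
  have "Const (1 / of_nat N) * (\<Sum>w | bij w. perm_subst w p) \<in> range esym_subst"
    by (intro range_esym_subst_closed perm_average_in_range)
  also have "(\<Sum>w | bij w. perm_subst w p) = of_nat N * p"
    using assms by (simp add: N_def)
  also have "Const (1 / of_nat N) * (of_nat N * p) = p"
    using Const_inverse_card_perms[where 'n = 'a and 'm = 'a]
    by (simp add: N_def flip: mult.assoc)
  finally show ?thesis .
qed


section \<open>The Vandermonde polynomial and the discriminant\<close>

lemma vandermonde_nonzero: "vandermonde \<noteq> 0"
  by (auto simp: vandermonde_def X_inject)

text \<open>Ordered pairs of distinct indices are split by order; exchanging the two entries of a
  decreasing pair costs one sign. The left side is visibly permuted by any \<open>w\<close>, which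
  gives invariance of the squared Vandermonde polynomial without computing signs of
  permutations.\<close>

lemma prod_diffprod:
  "prod diffprod UNIV =
    (-1) ^ card {(i :: 'n, j). i < j} * (vandermonde :: 'n::{finite,linorder} mpoly) ^ 2"
proof -
  let ?L = "{(i :: 'n, j). i < j}" and ?G = "{(i :: 'n, j). j < i}"
  define f :: "'n \<times> 'n \<Rightarrow> 'n mpoly" where "f = (\<lambda>(i, j). X i - X j)"
  have "prod diffprod (UNIV :: 'n set) = prod f (SIGMA i:UNIV. - {i})"
    unfolding diffprod_def f_def by (rule prod.Sigma) auto
  also have "(SIGMA i:UNIV. - {i}) = ?L \<union> ?G" by auto
  also have "prod f (?L \<union> ?G) = prod f ?L * prod f ?G"
    by (rule prod.union_disjoint) (auto intro: finite_subset[OF subset_UNIV])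
  also have "prod f ?G = (\<Prod>p\<in>?L. - f p)"
    by (rule prod.reindex_bij_witness[of _ prod.swap prod.swap]) (auto simp: f_def)
  also have "\<dots> = (-1) ^ card ?L * prod f ?L"
    by (rule prod_uminus)
  finally show ?thesis by (simp add: vandermonde_def f_def power2_eq_square mult_ac)
qed

lemma perm_subst_vandermonde:
  assumes "bij w"
  shows "perm_subst w (vandermonde ^ 2) = vandermonde ^ 2"
proof -
  let ?s = "(-1) ^ card {(i :: 'a, j). i < j} :: 'a mpoly"
  have "perm_subst w (prod diffprod UNIV) = (\<Prod>i\<in>UNIV. diffprod (w i))"
    using assms by (simp add: subst_prod perm_subst_diffprod)
  also have "\<dots> = prod diffprod UNIV"
    by (rule prod.reindex_bij_betw[OF assms])
  finally have "?s * perm_subst w (vandermonde ^ 2) = ?s * vandermonde ^ 2"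
    by (simp add: prod_diffprod subst_mult subst_power subst_uminus)
  then show ?thesis by simp
qed

text \<open>The description defining \<open>discr\<close> has a solution because the right side is
  symmetric, and only one because \<open>esym_subst\<close> is injective.\<close>

lemma esym_subst_discr: "esym_subst discr = vandermonde ^ 2"
  unfolding discr_def
proof (rule theI')
  show "\<exists>!d. esym_subst d = vandermonde ^ 2"
    using symmetric_in_range[OF perm_subst_vandermonde] esym_subst_inject
    by (metis imageE)
qed

lemma discr_nonzero: "(discr :: 'n::{finite,linorder} mpoly) \<noteq> 0"
  using esym_subst_discr[where 'a = 'n] vandermonde_nonzero[where 'a = 'n]
  by (auto simp: esym_subst_def)

text \<open>Hence one factor \<open>vandermonde ^ 2\<close> clears the denominators of all
  \<open>inv_jac j i\<close>.\<close>

lemma diffprod_dvd: "diffprod i dvd vandermonde ^ 2"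
proof -
  have "diffprod i dvd (-1) ^ card {(i :: 'a, j). i < j} * vandermonde ^ 2"
    unfolding prod_diffprod[symmetric] by (rule dvd_prodI) auto
  then show ?thesis by (cases "even (card {(i :: 'a, j). i < j})") auto
qed



section \<open>Operators in the two Weyl algebras\<close>

lemma weyl_z_additive:
  assumes "P \<in> carrier weyl_z"
  shows "P (f + g) = P f + P g"
proof -
  have *: "range (\<lambda>c. (*) (Const c)) \<union> range (\<lambda>i. (*) (X i)) \<union> range pdiff
      \<subseteq> carrier (End_ring :: ('a mpoly \<Rightarrow> 'a mpoly) ring)"
    by (auto simp: pdiff_add ring_distribs)
  show ?thesis
    using ring.generate_ring_in_carrier[OF ring_End_ring *, of P] assms by (simp add: weyl_z_def)
qed

lemma weyl_z_closed:
  "(*) (Const c) \<in> carrier weyl_z"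
  "(*) (X i) \<in> carrier weyl_z"
  "pdiff i \<in> carrier weyl_z"
  "S \<in> carrier weyl_z \<Longrightarrow> T \<in> carrier weyl_z \<Longrightarrow> S \<circ> T \<in> carrier weyl_z"
  "S \<in> carrier weyl_z \<Longrightarrow> T \<in> carrier weyl_z \<Longrightarrow> (\<lambda>f. S f + T f) \<in> carrier weyl_z"
proof -
  show "S \<in> carrier weyl_z \<Longrightarrow> T \<in> carrier weyl_z \<Longrightarrow> S \<circ> T \<in> carrier weyl_z"
    "S \<in> carrier weyl_z \<Longrightarrow> T \<in> carrier weyl_z \<Longrightarrow> (\<lambda>f. S f + T f) \<in> carrier weyl_z"
    using generate_ring.eng_mult[of S End_ring _ T] generate_ring.eng_add[of S End_ring _ T]
    by (auto simp: weyl_z_def)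
qed (auto simp: weyl_z_def intro!: generate_ring.incl)

lemma weyl_z_mult: "(*) p \<in> carrier weyl_z"
proof (induction p rule: mpoly_induct)
  case (add p q)
  then show ?case using weyl_z_closed(5)[of "(*) p" "(*) q"] by (simp add: ring_distribs)
next
  case (mult p q)
  have "(*) (p * q) = (*) p \<circ> (*) q" by (auto simp: mult.assoc)
  then show ?case using mult weyl_z_closed(4) by metis
qed (rule weyl_z_closed)+

lemma weyl_z_zero: "(\<lambda>_. 0) \<in> carrier weyl_z"
proof -
  have "(*) 0 = (\<lambda>_. 0 :: 'a mpoly)" by auto
  then show ?thesis using weyl_z_mult[of 0] by metis
qed

lemma weyl_z_sum:
  "(\<And>a. a \<in> A \<Longrightarrow> F a \<in> carrier weyl_z) \<Longrightarrow> (\<lambda>f. \<Sum>a\<in>A. F a f) \<in> carrier weyl_z"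
proof (induction A rule: infinite_finite_induct)
  case (insert x A)
  then show ?case using weyl_z_closed(5)[of "F x" "\<lambda>f. \<Sum>a\<in>A. F a f"] by simp
qed (simp_all add: weyl_z_zero)

lemma weyl_z_induct [consumes 1, case_names Const X pdiff add comp]:
  assumes "Q \<in> carrier weyl_z"
    and C: "\<And>c. P ((*) (Const c))"
    and "\<And>i. P ((*) (X i))" "\<And>i. P (pdiff i)"
    and add: "\<And>S T. S \<in> carrier weyl_z \<Longrightarrow> T \<in> carrier weyl_z \<Longrightarrow> P S \<Longrightarrow> P T \<Longrightarrow> P (\<lambda>f. S f + T f)"
    and comp: "\<And>S T. S \<in> carrier weyl_z \<Longrightarrow> T \<in> carrier weyl_z \<Longrightarrow> P S \<Longrightarrow> P T \<Longrightarrow> P (S \<circ> T)"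
  shows "P Q"
proof -
  have "Q \<in> generate_ring End_ring
     (range (\<lambda>c. (*) (Const c)) \<union> range (\<lambda>i. (*) (X i)) \<union> range pdiff)"
    using assms(1) by (simp add: weyl_z_def)
  then have "Q \<in> carrier weyl_z \<and> P Q"
  proof (induction rule: generate_ring.induct)
    case one
    have "(*) (Const 1) = (id :: 'a mpoly \<Rightarrow> 'a mpoly)"
      by (auto simp: fun_eq_iff)
    then show ?case using C[of 1] weyl_z_closed(1) by (metis End_ring_simps(3))
  next
    case (incl h)
    then show ?case using assms weyl_z_closed by auto
  next
    case (a_inv h)
    have m: "Const (-1) = (-1 :: 'a mpoly)"
      by (simp add: Const_def single_uminus)
    have "\<ominus>\<^bsub>End_ring\<^esub> h = (*) (Const (-1)) \<circ> h"
      using a_inv_End_ring[of h] weyl_z_additive[of h] a_inv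
      by (auto simp: fun_eq_iff m)
    then show ?case using comp[OF weyl_z_closed(1) _ C, of h] weyl_z_closed(4)[OF weyl_z_closed(1)] a_inv
      by metis
  next
    case (eng_add h1 h2)
    then show ?case using add[of h1 h2] weyl_z_closed(5)[of h1 h2] by simp
  next
    case (eng_mult h1 h2)
    then show ?case using comp[of h1 h2] weyl_z_closed(4)[of h1 h2] by (metis End_ring_simps(2))
  qed
  then show ?thesis by simp
qed

lemma weyl_s_mult: "(*) (to_fract p) \<in> carrier weyl_s"
proof (induction p rule: mpoly_induct)
  case (add p q)
  then show ?case using weyl_s_closed(6)[of "(*) (to_fract p)" "(*) (to_fract q)"] by (simp add: ring_distribs)
next
  case (mult p q)
  have "(*) (to_fract (p * q)) = (*) (to_fract p) \<circ> (*) (to_fract q)" by (auto simp: mult.assoc)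
  then show ?case using mult weyl_s_closed(5) by metis
qed (rule weyl_s_closed)+

lemma weyl_s_to_fract: "Q \<in> carrier weyl_s \<Longrightarrow> \<exists>g. Q (to_fract f) = to_fract g"
proof (induction arbitrary: f rule: weyl_s_induct)
  case (add S T)
  then show ?case by (metis to_fract_add)
next
  case (comp S T)
  then show ?case by (metis comp_apply)
qed (metis to_fract_mult rdiff_to_fract)+

text \<open>The values \<open>Q (f d\<^sup>n) / d\<^sup>n\<close> depend polynomially on the integer \<open>n\<close>, so those for
  \<open>n \<ge> 0\<close> determine the one for \<open>n = -1\<close>. Below, \<open>n\<close> is shifted by one.\<close>

lemma weyl_s_interpolate:
  assumes "Q \<in> carrier weyl_s" "d \<noteq> 0"
  shows "\<exists>T. \<forall>F. \<forall>n::nat. poly (T F) (of_nat n - 1) * (d ^ n / d) = Q (poly F (of_nat n - 1) * (d ^ n / d))"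
  using assms(1)
proof (induction rule: weyl_s_induct)
  case (rdiff i)
  have const: "rdiff i (of_nat n - 1 :: 'a ratfun) = 0" for n
    using rdiff_add[of i "of_nat n - 1" 1] by simp
  show ?case
  proof (intro exI[of _ "\<lambda>F. map_poly (rdiff i) F + Polynomial.smult (rdiff i d / d) (pCons 0 F)"] allI)
    fix F n
    define y where "y = d ^ n / d"
    \<comment> \<open>Here \<open>y\<close> stands for the power of \<open>d\<close> with exponent
      \<open>n - 1\<close>, which is \<open>-1\<close> at \<open>n = 0\<close>; the usual power rule
      persists.\<close>
    have "rdiff i y = (of_nat n - 1) * (rdiff i d / d) * y"
      using assms(2) by (simp add: y_def rdiff_divide rdiff_power field_simps)
    then show "poly (map_poly (rdiff i) F + Polynomial.smult (rdiff i d / d) (pCons 0 F)) (of_nat n - 1) *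
        (d ^ n / d) = rdiff i (poly F (of_nat n - 1) * (d ^ n / d))"
      unfolding y_def[symmetric]
      by (simp add: poly_map_rdiff const rdiff_mult) (simp add: algebra_simps)
  qed
next
  case (add S T)
  then obtain S' T' where
    "\<forall>F. \<forall>n::nat. poly (S' F) (of_nat n - 1) * (d ^ n / d) = S (poly F (of_nat n - 1) * (d ^ n / d))"
    "\<forall>F. \<forall>n::nat. poly (T' F) (of_nat n - 1) * (d ^ n / d) = T (poly F (of_nat n - 1) * (d ^ n / d))"
    by blast
  then show ?case
    by (intro exI[of _ "\<lambda>F. S' F + T' F"] allI) (simp only: poly_add distrib_right)
next
  case (comp S T)
  then obtain S' T' where
    "\<forall>F. \<forall>n::nat. poly (S' F) (of_nat n - 1) * (d ^ n / d) = S (poly F (of_nat n - 1) * (d ^ n / d))"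
    "\<forall>F. \<forall>n::nat. poly (T' F) (of_nat n - 1) * (d ^ n / d) = T (poly F (of_nat n - 1) * (d ^ n / d))"
    by blast
  then show ?case
    by (intro exI[of _ "\<lambda>F. S' (T' F)"]) simp
next
  case (Const c)
  show ?case by (intro exI[of _ "Polynomial.smult (to_fract (Const c))"]) (simp add: mult.assoc)
next
  case (X i)
  show ?case by (intro exI[of _ "Polynomial.smult (to_fract (X i))"]) (simp add: mult.assoc)
qed

text \<open>Operators in \<open>weyl_s\<close> are determined by their values on polynomials: for a
  fraction with denominator \<open>d\<close>, the interpolating polynomials of both operators agree
  at every natural number, hence also at \<open>-1\<close>. This gives uniqueness in
  \<open>weyl_embed\<close>.\<close>

lemma weyl_s_ext:
  fixes Q R :: "'n::{finite,linorder} ratfun \<Rightarrow> 'n ratfun"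
  assumes "Q \<in> carrier weyl_s" "R \<in> carrier weyl_s"
    and eq: "\<And>f. Q (to_fract f) = R (to_fract f)"
  shows "Q = R"
proof
  fix x :: "'n ratfun"
  obtain a b where "x = Fract a b" "b \<noteq> 0" by (cases x) auto
  then have x: "x = to_fract a / to_fract b" by (simp add: to_fract_def)
  define d where "d = to_fract b"
  have d: "d \<noteq> 0" using \<open>b \<noteq> 0\<close> by (simp add: d_def)
  obtain S T where
    S: "\<And>F n. poly (S F) (of_nat n - 1) * (d ^ n / d) = Q (poly F (of_nat n - 1) * (d ^ n / d))" and
    T: "\<And>F n. poly (T F) (of_nat n - 1) * (d ^ n / d) = R (poly F (of_nat n - 1) * (d ^ n / d))"
    using weyl_s_interpolate[OF assms(1) d] weyl_s_interpolate[OF assms(2) d] by blast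
  have "S [:to_fract a:] = T [:to_fract a:]"
  proof (rule poly_eqI_nat)
    fix n :: nat
    \<comment> \<open>The instance \<open>Suc n\<close> evaluates at \<open>n\<close>, where the
      argument is a polynomial and the hypothesis on \<open>Q\<close> and \<open>R\<close>
      applies.\<close>
    have "to_fract a * d ^ n = to_fract (a * b ^ n)" by (simp add: d_def to_fract_power)
    then have "Q (to_fract a * d ^ n) = R (to_fract a * d ^ n)" by (simp only: eq)
    then show "poly (S [:to_fract a:]) (of_nat n) = poly (T [:to_fract a:]) (of_nat n)"
      using S[of "[:to_fract a:]" "Suc n"] T[of "[:to_fract a:]" "Suc n"] d
      by simp (metis mult_right_cancel power_not_zero)
  qed
  \<comment> \<open>The instance \<open>0\<close> evaluates at \<open>-1\<close>, where the argument
    is \<open>x\<close> itself.\<close>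
  then show "Q x = R x"
    using S[of "[:to_fract a:]" 0] T[of "[:to_fract a:]" 0] by (simp add: x d_def)
qed

lemma weyl_embed_eqI:
  assumes "Q \<in> carrier weyl_s"
    and Q: "\<And>f. esym_fsubst (Q (to_fract f)) = to_fract (P (esym_subst f))"
  shows "weyl_embed P = Q"
  unfolding weyl_embed_def
proof (rule the_equality)
  show "Q \<in> carrier weyl_s \<and> (\<forall>f. \<exists>g. Q (to_fract f) = to_fract g \<and> esym_subst g = P (esym_subst f))"
    using assms weyl_s_to_fract[OF assms(1)] by (metis esym_fsubst_to_fract to_fract_eq_iff)
next
  fix R assume R: "R \<in> carrier weyl_s \<and>
    (\<forall>f. \<exists>g. R (to_fract f) = to_fract g \<and> esym_subst g = P (esym_subst f))"
  have "R (to_fract f) = Q (to_fract f)" for f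
  proof -
    obtain g where "R (to_fract f) = to_fract g" "esym_subst g = P (esym_subst f)" using R by blast
    then have "esym_fsubst (R (to_fract f)) = esym_fsubst (Q (to_fract f))"
      by (simp add: Q esym_fsubst_to_fract)
    then show ?thesis by (simp add: esym_fsubst_inject)
  qed
  then show "R = Q" using weyl_s_ext R assms(1) by blast
qed

section \<open>Computing with the connection action\<close>

lemma delta_act_simps:
  "delta_act ((*) (to_fract (Const c))) = (*) (to_fract (Const c))"
  "delta_act ((*) (to_fract (X i))) = (*) (to_fract (X i))"
  "delta_act (rdiff i) = delta_conn i"
  "delta_act id = id"
  "S \<in> carrier weyl_s \<Longrightarrow> T \<in> carrier weyl_s \<Longrightarrow> delta_act (S \<circ> T) = delta_act S \<circ> delta_act T"
  "S \<in> carrier weyl_s \<Longrightarrow> T \<in> carrier weyl_s \<Longrightarrow>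
    delta_act (\<lambda>f. S f + T f) = (\<lambda>f. delta_act S f + delta_act T f)"
proof -
  note A = is_delta_action_delta_act[unfolded is_delta_action_def]
  show "delta_act ((*) (to_fract (Const c))) = (*) (to_fract (Const c))"
    "delta_act ((*) (to_fract (X i))) = (*) (to_fract (X i))"
    "delta_act (rdiff i) = delta_conn i"
    by (simp_all add: A)
  show "delta_act id = id"
    using ring_hom_one[OF conjunct1[OF A]] by simp
  show "S \<in> carrier weyl_s \<Longrightarrow> T \<in> carrier weyl_s \<Longrightarrow> delta_act (S \<circ> T) = delta_act S \<circ> delta_act T"
    using ring_hom_mult[OF conjunct1[OF A], of S T] by simp
  show "S \<in> carrier weyl_s \<Longrightarrow> T \<in> carrier weyl_s \<Longrightarrow>
      delta_act (\<lambda>f. S f + T f) = (\<lambda>f. delta_act S f + delta_act T f)"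
    using ring_hom_add[OF conjunct1[OF A], of S T] by simp
qed

lemma delta_act_additive: "Q \<in> carrier weyl_s \<Longrightarrow> delta_act Q (x + y) = delta_act Q x + delta_act Q y"
  using ring_hom_closed[OF conjunct1[OF is_delta_action_delta_act[unfolded is_delta_action_def]], of Q]
  by simp

lemma delta_act_at_0: "Q \<in> carrier weyl_s \<Longrightarrow> delta_act Q 0 = 0"
  using delta_act_additive[of Q 0 0] by (metis add_0 add_cancel_right_right)

lemma delta_act_mult: "delta_act ((*) (to_fract p)) = (*) (to_fract p)"
proof (induction p rule: mpoly_induct)
  case (add p q)
  then show ?case
    using delta_act_simps(6)[OF weyl_s_mult[of p] weyl_s_mult[of q]] by (simp add: ring_distribs)
next
  case (mult p q)
  have *: "(*) (to_fract (p * q)) = (*) (to_fract p) \<circ> (*) (to_fract q)" by (auto simp: mult.assoc)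
  show ?case
    unfolding * using mult delta_act_simps(5)[OF weyl_s_mult[of p] weyl_s_mult[of q]] by metis
qed (rule delta_act_simps)+


section \<open>Lifting operators along the ramified covering\<close>

lemma vandermonde_square: "to_fract vandermonde ^ 2 = esym_fsubst (to_fract discr)"
  by (simp add: esym_fsubst_to_fract esym_subst_discr to_fract_power)

text \<open>Differentiating \<open>vandermonde_square\<close> gives twice \<open>?v\<close> times
  its derivative as the derivative of the discriminant. This is why \<open>delta_conn\<close>
  carries the factor one half.\<close>

lemma sdiff_vandermonde:
  "sdiff j (to_fract vandermonde) =
    esym_fsubst (rdiff j (to_fract discr) / (2 * to_fract discr)) * to_fract vandermonde"
  (is "sdiff j ?v = _")
proof -
  have v: "?v \<noteq> 0" by (simp add: vandermonde_nonzero)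
  have two: "esym_fsubst 2 = 2"
    using esym_fsubst_add[of 1 1] by (simp add: esym_fsubst_1)
  have "2 * ?v * sdiff j ?v = sdiff j (?v ^ 2)"
    by (simp add: power2_eq_square sdiff_mult)
  also have "\<dots> = esym_fsubst (rdiff j (to_fract discr))"
    unfolding vandermonde_square by (rule sdiff_esym_fsubst)
  finally have "sdiff j ?v = esym_fsubst (rdiff j (to_fract discr)) / (2 * ?v)"
    using v two_ratfun[where 'n = 'a] by (simp add: field_simps)
  also have "\<dots> = esym_fsubst (rdiff j (to_fract discr)) / (2 * ?v ^ 2) * ?v"
    using v by (simp add: power2_eq_square)
  finally show ?thesis
    by (simp add: esym_fsubst_divide esym_fsubst_mult two vandermonde_square)
qed

text \<open>The clauses make \<open>T\<close> extend \<open>Q\<close> along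
  \<open>esym_fsubst\<close>, realize the action \<open>delta_act Q\<close> on multiples of the
  Vandermonde polynomial, and commute with permutations. Each clause is stable under sums and
  compositions, so lifts need constructing only for generators.\<close>

definition lifted ::
    "('n::{finite,linorder} ratfun \<Rightarrow> 'n ratfun) \<Rightarrow> ('n ratfun \<Rightarrow> 'n ratfun) \<Rightarrow> bool" where
  "lifted Q T \<longleftrightarrow> Q \<in> carrier weyl_s \<and>
     (\<forall>x. T (esym_fsubst x) = esym_fsubst (Q x)) \<and>
     (\<forall>x. T (esym_fsubst x * to_fract vandermonde) = esym_fsubst (delta_act Q x) * to_fract vandermonde) \<and>
     (\<forall>w x. bij w \<longrightarrow> T (perm_fsubst w x) = perm_fsubst w (T x))"

lemma lifted_mult: "lifted ((*) (to_fract p)) ((*) (to_fract (esym_subst p)))"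
  by (simp add: lifted_def weyl_s_mult delta_act_mult esym_fsubst_mult esym_fsubst_to_fract
      fsubst_mult fsubst_to_fract alg_indep_perm perm_subst_esym_subst mult.assoc)

text \<open>On a multiple of the Vandermonde polynomial the Leibniz rule and
  \<open>sdiff_vandermonde\<close> reproduce \<open>delta_conn\<close>.\<close>

lemma lifted_sdiff: "lifted (rdiff j) (sdiff j)"
  by (simp add: lifted_def weyl_s_closed sdiff_esym_fsubst perm_fsubst_sdiff sdiff_mult sdiff_vandermonde
      delta_act_simps delta_conn_def esym_fsubst_add esym_fsubst_mult ring_distribs mult.assoc
      del: times_divide_eq_right times_divide_eq_left)

lemma lifted_add:
  assumes "lifted Q S" "lifted R T"
  shows "lifted (\<lambda>x. Q x + R x) (\<lambda>x. S x + T x)"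
  using assms
  by (auto simp: lifted_def weyl_s_closed delta_act_simps esym_fsubst_add fsubst_add alg_indep_perm ring_distribs)

lemma lifted_comp:
  assumes "lifted Q S" "lifted R T"
  shows "lifted (Q \<circ> R) (S \<circ> T)"
  using assms by (auto simp: lifted_def weyl_s_closed delta_act_simps)

lemma lifted_id: "lifted id id"
  by (simp add: lifted_def weyl_s_closed delta_act_simps)

lemma weyl_embed_lifted:
  assumes "lifted Q T" "\<forall>f. T (to_fract f) = to_fract (P f)"
  shows "weyl_embed P = Q"
  by (rule weyl_embed_eqI) (use assms in \<open>simp_all add: lifted_def flip: assms(2) esym_fsubst_to_fract\<close>)

text \<open>Allowing negative powers of the discriminant on the right makes the condition stable
  under composition.\<close>

definition clearable :: "('n::{finite,linorder} ratfun \<Rightarrow> 'n ratfun) \<Rightarrow> bool" where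
  "clearable T \<longleftrightarrow> (\<forall>n. \<exists>N. \<exists>P\<in>carrier weyl_z. \<forall>f.
     to_fract (P f) = to_fract (vandermonde ^ 2) ^ N * T (to_fract f / to_fract (vandermonde ^ 2) ^ n))"

lemma clearable_mult: "clearable ((*) (to_fract p))"
  unfolding clearable_def
proof
  fix n
  have "\<forall>f. to_fract (p * f) = to_fract (vandermonde ^ 2) ^ n *
      (to_fract p * (to_fract f / to_fract (vandermonde ^ 2) ^ n))"
    by (simp add: vandermonde_nonzero)
  then show "\<exists>N. \<exists>P\<in>carrier weyl_z. \<forall>f. to_fract (P f) =
      to_fract (vandermonde ^ 2) ^ N * (to_fract p * (to_fract f / to_fract (vandermonde ^ 2) ^ n))"
    using weyl_z_mult by blast
qed

lemma clearable_add:
  assumes "clearable S" "clearable T"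
  shows "clearable (\<lambda>x. S x + T x)"
  unfolding clearable_def
proof
  fix n
  let ?e = "to_fract (vandermonde ^ 2) :: 'a ratfun"
  obtain M P where P: "P \<in> carrier weyl_z" "\<And>f. to_fract (P f) = ?e ^ M * S (to_fract f / ?e ^ n)"
    using assms(1) unfolding clearable_def by blast
  obtain N R where R: "R \<in> carrier weyl_z" "\<And>f. to_fract (R f) = ?e ^ N * T (to_fract f / ?e ^ n)"
    using assms(2) unfolding clearable_def by blast
  let ?U = "\<lambda>f. ((*) ((vandermonde ^ 2) ^ N) \<circ> P) f + ((*) ((vandermonde ^ 2) ^ M) \<circ> R) f"
  have U: "?U \<in> carrier weyl_z"
    by (intro weyl_z_closed weyl_z_mult P R)
  have "to_fract (?U f) = ?e ^ (M + N) * (S (to_fract f / ?e ^ n) + T (to_fract f / ?e ^ n))" for f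
    by (simp add: P R to_fract_power[of "vandermonde ^ 2"] power_add ring_distribs mult_ac)
  then show "\<exists>N. \<exists>P\<in>carrier weyl_z. \<forall>f. to_fract (P f) =
      ?e ^ N * (S (to_fract f / ?e ^ n) + T (to_fract f / ?e ^ n))"
    by (intro exI[of _ "M + N"] bexI[of _ ?U] allI U)
qed

lemma clearable_comp:
  assumes "clearable S" "clearable T"
  shows "clearable (S \<circ> T)"
  unfolding clearable_def
proof
  fix n
  let ?e = "to_fract (vandermonde ^ 2) :: 'a ratfun"
  obtain N R where R: "R \<in> carrier weyl_z" "\<And>f. to_fract (R f) = ?e ^ N * T (to_fract f / ?e ^ n)"
    using assms(2) unfolding clearable_def by blast
  \<comment> \<open>The exponent \<open>N\<close> produced by \<open>T\<close> is taken as the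
    negative power allowed for \<open>S\<close>.\<close>
  obtain M P where P: "P \<in> carrier weyl_z" "\<And>f. to_fract (P f) = ?e ^ M * S (to_fract f / ?e ^ N)"
    using assms(1) unfolding clearable_def by blast
  have "P \<circ> R \<in> carrier weyl_z"
    by (intro weyl_z_closed P R)
  moreover have "to_fract ((P \<circ> R) f) = ?e ^ M * (S \<circ> T) (to_fract f / ?e ^ n)" for f
    by (simp add: P R vandermonde_nonzero)
  ultimately show "\<exists>N. \<exists>P\<in>carrier weyl_z. \<forall>f. to_fract (P f) = ?e ^ N * (S \<circ> T) (to_fract f / ?e ^ n)"
    by blast
qed

text \<open>\<open>D\<close> clears the denominators of the coefficients; the quotient by a power of
  \<open>?e\<close> is treated by the Leibniz rule.\<close>

lemma clearable_sdiff: "clearable (sdiff j)"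
  unfolding clearable_def
proof
  fix n
  let ?e = "to_fract (vandermonde ^ 2) :: 'a ratfun"
  have e: "?e \<noteq> 0" by (simp add: vandermonde_nonzero)
  have "\<exists>r. \<forall>i. ?e * inv_jac j i = to_fract (r i)"
  proof (rule choice, rule allI)
    fix i :: 'a
    obtain s where s: "vandermonde ^ 2 = diffprod i * s" using diffprod_dvd by (rule dvdE)
    have "?e * inv_jac j i = to_fract (s * ((-1) ^ (rank j - 1) * X i ^ (CARD('a) - rank j)))"
      unfolding s inv_jac_def by (simp add: diffprod_nonzero)
    then show "\<exists>r. ?e * inv_jac j i = to_fract r" by blast
  qed
  then obtain r where r: "\<And>i. ?e * inv_jac j i = to_fract (r i)" by blast
  define D where "D f = (\<Sum>i\<in>UNIV. ((*) (r i) \<circ> pdiff i) f)" for f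
  have D: "to_fract (D f) = ?e * sdiff j (to_fract f)" for f
    by (simp add: D_def sdiff_def to_fract_sum sum_distrib_left rdiff_to_fract r[symmetric] mult.assoc)
  \<comment> \<open>The power \<open>?e ^ n\<close> comes from the discriminant, so its derivative
    along \<open>sdiff j\<close> is again a polynomial.\<close>
  define u where "u = esym_subst (pdiff j (discr ^ n))"
  have "?e ^ n = to_fract (esym_subst (discr ^ n))"
    by (simp add: to_fract_power esym_subst_discr[symmetric]) (simp add: esym_subst_def subst_power to_fract_power)
  then have u: "sdiff j (?e ^ n) = to_fract u"
    by (simp only: sdiff_esym_subst u_def)
  \<comment> \<open>The Leibniz rule for \<open>to_fract f = (to_fract f / ?e ^ n) * ?e ^ n\<close>,
    multiplied by \<open>?e ^ Suc n\<close> and solved for the derivative of the quotient.\<close>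
  let ?U = "\<lambda>f. ((*) ((vandermonde ^ 2) ^ n) \<circ> D) f + - (vandermonde ^ 2 * u) * f"
  have U: "?U \<in> carrier weyl_z"
    unfolding D_def[abs_def] by (intro weyl_z_closed weyl_z_mult weyl_z_sum)
  have "to_fract (?U f) = ?e ^ Suc (n + n) * sdiff j (to_fract f / ?e ^ n)" for f
  proof -
    have "sdiff j (to_fract f) = sdiff j (to_fract f / ?e ^ n * ?e ^ n)"
      using e by simp
    also have "\<dots> = sdiff j (to_fract f / ?e ^ n) * ?e ^ n + to_fract f / ?e ^ n * to_fract u"
      by (simp only: sdiff_mult u)
    finally have "?e * ?e ^ n * sdiff j (to_fract f) = ?e ^ Suc (n + n) * sdiff j (to_fract f / ?e ^ n) +
        ?e * (to_fract f * to_fract u)"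
      using e by (simp add: power_add ring_distribs mult_ac)
    moreover have "to_fract (?U f) = ?e * ?e ^ n * sdiff j (to_fract f) - ?e * (to_fract f * to_fract u)"
      by (simp add: D to_fract_power mult_ac)
    ultimately show ?thesis by simp
  qed
  then show "\<exists>N. \<exists>P\<in>carrier weyl_z. \<forall>f. to_fract (P f) = ?e ^ N * sdiff j (to_fract f / ?e ^ n)"
    by (intro exI[of _ "Suc (n + n)"] bexI[of _ ?U] allI U)
qed

lemma weyl_s_lift:
  assumes "Q \<in> carrier weyl_s"
  shows "\<exists>T. lifted Q T \<and> clearable T"
  using assms
proof (induction rule: weyl_s_induct)
  case (Const c)
  show ?case using lifted_mult clearable_mult by blast
next
  case (X i)
  show ?case using lifted_mult clearable_mult by blast
next
  case (rdiff i)
  show ?case using lifted_sdiff clearable_sdiff by blast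
next
  case (add S T)
  then show ?case using lifted_add clearable_add by blast
next
  case (comp S T)
  then show ?case using lifted_comp clearable_comp by blast
qed

lemma weyl_z_symI:
  assumes "P \<in> carrier weyl_z" "lifted Q T" "\<And>f. T (to_fract f) = to_fract (P f)"
  shows "P \<in> weyl_z_sym"
proof -
  have "perm_subst w (P f) = P (perm_subst w f)" if w: "bij w" for w f
  proof -
    have "to_fract (perm_subst w (P f)) = perm_fsubst w (T (to_fract f))"
      using w by (simp add: assms(3) fsubst_to_fract alg_indep_perm)
    also have "\<dots> = T (perm_fsubst w (to_fract f))"
      using assms(2) w by (simp add: lifted_def)
    also have "\<dots> = to_fract (P (perm_subst w f))"
      using w by (simp add: assms(3) fsubst_to_fract alg_indep_perm)
    finally show ?thesis by simp
  qed
  then show ?thesis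
    using assms(1) by (auto simp: weyl_z_sym_def)
qed

text \<open>The case of exponent \<open>0\<close> in \<open>clearable\<close> gives \<open>N\<close>
  and \<open>P\<close>. Since \<open>?e ^ N\<close> is the image of \<open>discr ^ N\<close>, the
  clearing factor also belongs to the \<open>weyl_s\<close> side, and the lift makes
  \<open>P\<close> invariant.\<close>

lemma weyl_s_clear_denominators:
  assumes "Q \<in> carrier weyl_s"
  shows "\<exists>N. \<exists>P\<in>weyl_z_sym. \<exists>T. lifted ((*) (to_fract (discr ^ N)) \<circ> Q) T \<and>
    (\<forall>f. T (to_fract f) = to_fract (P f))"
proof -
  let ?e = "to_fract (vandermonde ^ 2) :: 'a ratfun"
  obtain S where S: "lifted Q S" "clearable S"
    using weyl_s_lift[OF assms] by blast
  obtain N P where P: "P \<in> carrier weyl_z" "\<And>f. to_fract (P f) = ?e ^ N * S (to_fract f / ?e ^ 0)"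
    using S(2) unfolding clearable_def by blast
  define T where "T = (*) (to_fract (esym_subst (discr ^ N))) \<circ> S"
  have T: "lifted ((*) (to_fract (discr ^ N)) \<circ> Q) T"
    unfolding T_def by (intro lifted_comp lifted_mult S)
  have "to_fract (esym_subst (discr ^ N)) = ?e ^ N"
    by (simp only: esym_subst_discr[symmetric] to_fract_power[symmetric])
       (simp add: esym_subst_def subst_power)
  then have "T (to_fract f) = to_fract (P f)" for f
    by (simp add: T_def P)
  with P(1) T weyl_z_symI[OF P(1) T] show ?thesis by blast
qed


section \<open>Averaging over permutations\<close>

text \<open>The left module over the polynomials in the \<open>z\<^sub>i\<close> generated by the lifts. It contains the
  extensions of all elements of \<open>weyl_z\<close>, because \<open>\<partial>/\<partial>z\<^sub>i\<close> is a combination of the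
  derivations \<open>sdiff j\<close> with polynomial coefficients.\<close>

inductive_set lift_span :: "('n::{finite,linorder} ratfun \<Rightarrow> 'n ratfun) set" where
  zero: "(\<lambda>_. 0) \<in> lift_span"
| step: "lifted Q T \<Longrightarrow> U \<in> lift_span \<Longrightarrow> (\<lambda>x. to_fract h * T x + U x) \<in> lift_span"

lemma lift_span_single: "lifted Q T \<Longrightarrow> (\<lambda>x. to_fract h * T x) \<in> lift_span"
  using lift_span.step[OF _ lift_span.zero, of Q T h] by simp

lemma lift_span_add: "U \<in> lift_span \<Longrightarrow> V \<in> lift_span \<Longrightarrow> (\<lambda>x. U x + V x) \<in> lift_span"
  by (induction rule: lift_span.induct) (auto simp: add.assoc intro: lift_span.step)

lemma lift_span_sum:
  "(\<And>a. a \<in> A \<Longrightarrow> F a \<in> lift_span) \<Longrightarrow> (\<lambda>x. \<Sum>a\<in>A. F a x) \<in> lift_span"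
  by (induction A rule: infinite_finite_induct) (auto intro: lift_span_add lift_span.zero)

lemma lift_span_mult: "U \<in> lift_span \<Longrightarrow> (\<lambda>x. to_fract p * U x) \<in> lift_span"
proof (induction rule: lift_span.induct)
  case (step Q T U h)
  then show ?case
    using lift_span.step[of Q T _ "p * h"] by (simp add: ring_distribs mult.assoc)
qed (simp add: lift_span.zero)

text \<open>The Leibniz rule differentiates the coefficient or the lift. In the latter case
  \<open>rdiff_conv_sdiff\<close> turns the derivative into polynomial multiples of
  \<open>sdiff j \<circ> T\<close>, which are again lifts.\<close>

lemma lift_span_rdiff: "U \<in> lift_span \<Longrightarrow> (\<lambda>x. rdiff i (U x)) \<in> lift_span"
proof (induction rule: lift_span.induct)
  case (step Q T U h)
  have "(\<lambda>x. rdiff i (to_fract h * T x + U x)) = (\<lambda>x. to_fract (pdiff i h) * T x +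
      ((\<Sum>j\<in>UNIV. to_fract (h * pdiff i (esym (rank j))) * (sdiff j \<circ> T) x) + rdiff i (U x)))"
    by (simp add: rdiff_add rdiff_mult rdiff_to_fract rdiff_conv_sdiff[of i "T _"] sum_distrib_left mult.assoc add.assoc)
  moreover have "(\<lambda>x. to_fract (pdiff i h) * T x +
      ((\<Sum>j\<in>UNIV. to_fract (h * pdiff i (esym (rank j))) * (sdiff j \<circ> T) x) + rdiff i (U x))) \<in> lift_span"
    by (intro lift_span.step[OF step(1)] lift_span_add lift_span_sum step
        lift_span_single[OF lifted_comp[OF lifted_sdiff step(1)]])
  ultimately show ?case by simp
qed (simp add: lift_span.zero)

text \<open>Stability of the span is stated for all \<open>V\<close> so that the claim survives
  composition; applying it to the identity later places \<open>U\<close> itself in the span.\<close>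

lemma weyl_z_extension:
  assumes "P \<in> carrier weyl_z"
  shows "\<exists>U. (\<forall>f. U (to_fract f) = to_fract (P f)) \<and> (\<forall>V\<in>lift_span. (\<lambda>x. U (V x)) \<in> lift_span)"
  using assms
proof (induction rule: weyl_z_induct)
  case (Const c)
  show ?case by (intro exI[of _ "(*) (to_fract (Const c))"]) (simp add: lift_span_mult)
next
  case (X i)
  show ?case by (intro exI[of _ "(*) (to_fract (X i))"]) (simp add: lift_span_mult)
next
  case (pdiff i)
  show ?case by (intro exI[of _ "rdiff i"]) (simp add: lift_span_rdiff rdiff_to_fract)
next
  case (add S T)
  then obtain S' T' where
    "\<forall>f. S' (to_fract f) = to_fract (S f)" "\<forall>V\<in>lift_span. (\<lambda>x. S' (V x)) \<in> lift_span"
    "\<forall>f. T' (to_fract f) = to_fract (T f)" "\<forall>V\<in>lift_span. (\<lambda>x. T' (V x)) \<in> lift_span"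
    by blast
  then show ?case by (intro exI[of _ "\<lambda>x. S' x + T' x"]) (simp add: lift_span_add)
next
  case (comp S T)
  then obtain S' T' where
    "\<forall>f. S' (to_fract f) = to_fract (S f)" "\<forall>V\<in>lift_span. (\<lambda>x. S' (V x)) \<in> lift_span"
    "\<forall>f. T' (to_fract f) = to_fract (T f)" "\<forall>V\<in>lift_span. (\<lambda>x. T' (V x)) \<in> lift_span"
    by blast
  then show ?case by (intro exI[of _ "\<lambda>x. S' (T' x)"]) simp
qed

text \<open>A lift commutes with permutations, so conjugation changes only its polynomial
  coefficient \<open>h\<close>. The sum of the permuted coefficients is symmetric and therefore
  comes from an element of \<open>weyl_s\<close>.\<close>

lemma lift_span_average:
  fixes U :: "'n::{finite,linorder} ratfun \<Rightarrow> 'n ratfun"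
  assumes "U \<in> lift_span"
  shows "\<exists>Q. lifted Q (\<lambda>x. \<Sum>w | bij w. perm_fsubst w (U (perm_fsubst (inv_into UNIV w) x)))"
  using assms
proof (induction rule: lift_span.induct)
  case zero
  have "(*) (to_fract (esym_subst 0)) = (\<lambda>x :: 'n ratfun. \<Sum>w | bij (w :: 'n \<Rightarrow> 'n). perm_fsubst w 0)"
    by (auto simp: esym_subst_def fsubst_0 alg_indep_perm intro!: sum.neutral[symmetric])
  then show ?case
    using lifted_mult[of "0 :: 'n mpoly"] by metis
next
  case (step Q T U h)
  then obtain R where R: "lifted R (\<lambda>x. \<Sum>w | bij w. perm_fsubst w (U (perm_fsubst (inv_into UNIV w) x)))"
    by blast
  obtain g where g: "(\<Sum>w | bij w. perm_subst w h) = esym_subst g"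
    using perm_average_in_range[of h] by blast
  have "perm_fsubst w (T (perm_fsubst (inv_into UNIV w) x)) = T x" if w: "bij w" for w x
  proof -
    obtain a b where x: "x = Fract a b" "b \<noteq> 0" by (cases x) auto
    have "perm_fsubst w (perm_fsubst (inv_into UNIV w) x) = x"
      using w x bij_imp_bij_inv[OF w]
      by (simp add: fsubst_Fract alg_indep_perm subst_eq_0_iff perm_subst_inv(2))
    moreover have "perm_fsubst w (T (perm_fsubst (inv_into UNIV w) x)) =
        T (perm_fsubst w (perm_fsubst (inv_into UNIV w) x))"
      using step(1) w by (simp add: lifted_def)
    ultimately show ?thesis by simp
  qed
  then have "(\<Sum>w | bij w. perm_fsubst w (to_fract h * T (perm_fsubst (inv_into UNIV w) x) +
        U (perm_fsubst (inv_into UNIV w) x))) =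
      (\<Sum>w | bij w. to_fract (perm_subst w h) * T x + perm_fsubst w (U (perm_fsubst (inv_into UNIV w) x)))"
    for x
    by (intro sum.cong) (simp_all add: fsubst_add fsubst_mult fsubst_to_fract alg_indep_perm)
  also have "\<dots> x = ((*) (to_fract (esym_subst g)) \<circ> T) x +
      (\<Sum>w | bij w. perm_fsubst w (U (perm_fsubst (inv_into UNIV w) x)))" for x
    by (simp add: sum.distrib g[symmetric] to_fract_sum sum_distrib_right)
  finally show ?case
    using lifted_add[OF lifted_comp[OF lifted_mult[of g] step(1)] R] by auto
qed

text \<open>On polynomials an invariant operator equals its own conjugates, so the averaged
  extension \<open>S\<close> is \<open>?N\<close> times the operator there; the constant
  \<open>c\<close> removes this factor.\<close>

lemma weyl_z_sym_lift:
  fixes P :: "'n::{finite,linorder} mpoly \<Rightarrow> 'n mpoly"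
  assumes "P \<in> weyl_z_sym"
  shows "\<exists>Q T. lifted Q T \<and> (\<forall>f. T (to_fract f) = to_fract (P f))"
proof -
  let ?N = "card {w :: 'n \<Rightarrow> 'n. bij w}"
  have P: "P \<in> carrier weyl_z" "\<And>w f. bij w \<Longrightarrow> perm_subst w (P f) = P (perm_subst w f)"
    using assms by (auto simp: weyl_z_sym_def fun_eq_iff)
  have "(\<lambda>x. x) \<in> lift_span"
    using lift_span_single[OF lifted_id, of 1] by simp
  with weyl_z_extension[OF P(1)] obtain U where
    U: "\<And>f. U (to_fract f) = to_fract (P f)" "U \<in> lift_span"
    by (metis (no_types, lifting) ext)
  define S where "S x = (\<Sum>w | bij w. perm_fsubst w (U (perm_fsubst (inv_into UNIV w) x)))" for x
  define c where "c = (Const (1 / of_nat ?N) :: 'n mpoly)"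
  obtain Q where Q: "lifted Q S"
    using lift_span_average[OF U(2)] by (auto simp: S_def[abs_def])
  have S: "S (to_fract f) = of_nat ?N * to_fract (P f)" for f
  proof -
    have "S (to_fract f) = (\<Sum>w | bij (w :: 'n \<Rightarrow> 'n). to_fract (P f))"
      unfolding S_def
    proof (rule sum.cong)
      fix w :: "'n \<Rightarrow> 'n" assume "w \<in> {w. bij w}"
      then show "perm_fsubst w (U (perm_fsubst (inv_into UNIV w) (to_fract f))) = to_fract (P f)"
        using bij_imp_bij_inv[of w]
        by (simp add: fsubst_to_fract alg_indep_perm U P(2) perm_subst_inv(2))
    qed simp
    then show ?thesis by simp
  qed
  have "lifted ((*) (to_fract c) \<circ> Q) ((*) (to_fract (esym_subst c)) \<circ> S)"
    by (intro lifted_comp lifted_mult Q)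
  moreover have "((*) (to_fract (esym_subst c)) \<circ> S) (to_fract f) = to_fract (P f)" for f
  proof -
    have "to_fract (esym_subst c) * of_nat ?N = to_fract (c * of_nat ?N)"
      by (simp add: esym_subst_def c_def to_fract_def of_nat_fract)
    also have "\<dots> = 1"
      unfolding c_def by (simp add: Const_inverse_card_perms)
    finally show ?thesis by (simp add: S flip: mult.assoc)
  qed
  ultimately show ?thesis by blast
qed

section \<open>Invariant operators obtained by averaging\<close>

lemma weyl_z_conjugate:
  assumes "P \<in> carrier weyl_z" "bij w"
  shows "(\<lambda>f. perm_subst w (P (perm_subst (inv_into UNIV w) f))) \<in> carrier weyl_z"
  using assms(1)
proof (induction rule: weyl_z_induct)
  case (Const c)
  show ?case using assms(2) weyl_z_mult by (simp add: subst_mult perm_subst_inv)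
next
  case (X i)
  show ?case using assms(2) weyl_z_mult by (simp add: subst_mult perm_subst_inv)
next
  case (pdiff i)
  show ?case using assms(2) weyl_z_closed by (simp add: perm_subst_pdiff perm_subst_inv)
next
  case (add S T)
  then show ?case using weyl_z_closed(5) by (simp add: subst_add)
next
  case (comp S T)
  from weyl_z_closed(4)[OF comp(3,4)] show ?case
    using assms(2) by (simp add: o_def perm_subst_inv)
qed

lemma weyl_z_average:
  fixes P :: "'n::{finite,linorder} mpoly \<Rightarrow> 'n mpoly"
  assumes "P \<in> carrier weyl_z"
  shows "(\<lambda>f. \<Sum>w | bij w. perm_subst w (P (perm_subst (inv_into UNIV w) f))) \<in> weyl_z_sym"
  unfolding weyl_z_sym_def
proof (intro CollectI conjI allI impI ext)
  show "(\<lambda>f. \<Sum>w | bij w. perm_subst w (P (perm_subst (inv_into UNIV w) f))) \<in> carrier weyl_z"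
    by (rule weyl_z_sum) (simp add: weyl_z_conjugate assms)
  fix v :: "'n \<Rightarrow> 'n" and f assume v: "bij v"
  have "perm_subst v (\<Sum>w | bij w. perm_subst w (P (perm_subst (inv_into UNIV w) f))) =
      (\<Sum>w | bij w. perm_subst (v \<circ> w) (P (perm_subst (inv_into UNIV w) f)))"
    by (simp add: subst_sum subst_subst)
  also have "\<dots> = (\<Sum>w | bij w. perm_subst w (P (perm_subst (inv_into UNIV w) (perm_subst v f))))"
  \<comment> \<open>Left translation by \<open>v\<close> permutes the summation index and moves
    \<open>v\<close> onto the argument.\<close>
  proof (rule sum.reindex_bij_witness[of _ "\<lambda>w. inv_into UNIV v \<circ> w" "\<lambda>w. v \<circ> w"])
    fix w :: "'n \<Rightarrow> 'n" assume "w \<in> {w. bij w}"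
    then have w: "bij w" by simp
    show "inv_into UNIV v \<circ> (v \<circ> w) = w" "v \<circ> (inv_into UNIV v \<circ> w) = w"
      using v by (simp_all add: fun_eq_iff bij_is_inj bij_is_surj surj_f_inv_f)
    show "v \<circ> w \<in> {w. bij w}" "inv_into UNIV v \<circ> w \<in> {w. bij w}"
      using v w by (simp_all add: bij_comp bij_imp_bij_inv)
    show "perm_subst (v \<circ> w) (P (perm_subst (inv_into UNIV (v \<circ> w)) (perm_subst v f))) =
        perm_subst (v \<circ> w) (P (perm_subst (inv_into UNIV w) f))"
      using v w by (simp add: o_inv_distrib subst_subst bij_is_inj)
  qed
  finally show "(perm_subst v \<circ> (\<lambda>f. \<Sum>w | bij w. perm_subst w (P (perm_subst (inv_into UNIV w) f)))) f =
      ((\<lambda>f. \<Sum>w | bij w. perm_subst w (P (perm_subst (inv_into UNIV w) f))) \<circ> perm_subst v) f"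
    by simp
qed

text \<open>The symmetric operators act transitively on the nonzero antisymmetric polynomials: take any
  operator in \<open>weyl_z\<close> sending \<open>g\<close> to \<open>1\<close>, follow it by multiplication with the
  Vandermonde polynomial, and average.\<close>

lemma weyl_z_sym_to_vandermonde:
  fixes a :: "'n::{finite,linorder} mpoly"
  assumes "a \<noteq> 0"
  shows "\<exists>P\<in>weyl_z_sym. P (esym_subst a * vandermonde) = vandermonde"
proof -
  let ?v = "vandermonde :: 'n mpoly" and ?N = "card {w :: 'n \<Rightarrow> 'n. bij w}"
  define g where "g = esym_subst a * ?v"
  have "g \<noteq> 0"
    using assms esym_subst_inject[of a 0] by (simp add: g_def vandermonde_nonzero) (simp add: esym_subst_def)
  moreover have "g \<in> {P g | P. P \<in> carrier weyl_z}"
    using weyl_z_mult[of 1] by (auto intro!: exI[of _ "(*) 1"])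
  moreover have "pdiff i p \<in> {P g | P. P \<in> carrier weyl_z}" if "p \<in> {P g | P. P \<in> carrier weyl_z}" for i p
  proof -
    from that obtain P where "P \<in> carrier weyl_z" "p = P g" by blast
    then show ?thesis
      using weyl_z_closed(4)[OF weyl_z_closed(3)] by (intro CollectI exI[of _ "pdiff i \<circ> P"]) simp
  qed
  \<comment> \<open>The images of \<open>g\<close> under \<open>weyl_z\<close> are closed under
    differentiation and contain \<open>g\<close>, so they contain a nonzero constant.\<close>
  ultimately obtain c P0 where c: "c \<noteq> 0" "Const c = P0 g" and P0: "P0 \<in> carrier weyl_z"
    using const_in_deriv_closed[of g "{P g | P. P \<in> carrier weyl_z}"] by blast
  \<comment> \<open>The two constants cancel \<open>c\<close> and the number of
    permutations.\<close>
  define d where "d = Const (1 / of_nat ?N) * Const (1 / c) * ?v"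
  define P where "P f = (\<Sum>w | bij w. perm_subst w (((*) d \<circ> P0) (perm_subst (inv_into UNIV w) f)))" for f
  have "P \<in> weyl_z_sym"
    unfolding P_def[abs_def] by (intro weyl_z_average weyl_z_closed weyl_z_mult P0)
  moreover have "perm_subst w (((*) d \<circ> P0) (perm_subst (inv_into UNIV w) g)) = Const (1 / of_nat ?N) * ?v"
    if w: "bij w" for w
  proof -
    have iw: "bij (inv_into UNIV w)" using w by (rule bij_imp_bij_inv)
    have "d * Const c = Const (1 / of_nat ?N) * ?v * (Const (1 / c) * Const c)"
      by (simp add: d_def mult_ac)
    also have "Const (1 / c) * Const c = (1 :: 'n mpoly)"
      using c(1) by (simp flip: Const_mult)
    finally have d: "d * Const c = Const (1 / of_nat ?N) * ?v" by simp
    \<comment> \<open>Invariance of the square leaves only the two signs. In the negative case the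
      sign from \<open>g\<close> cancels the one from \<open>d\<close>, so every conjugate
      contributes the same amount.\<close>
    have "(perm_subst w ?v) ^ 2 = ?v ^ 2"
      using perm_subst_vandermonde[OF w] by (simp add: subst_power)
    then consider "perm_subst w ?v = ?v" | "perm_subst w ?v = - ?v"
      by (auto simp: power2_eq_iff)
    then show ?thesis
    proof cases
      case 1
      then have "perm_subst (inv_into UNIV w) ?v = ?v"
        using perm_subst_inv(1)[OF w, of ?v] by simp
      then have "perm_subst (inv_into UNIV w) g = g"
        by (simp add: g_def subst_mult perm_subst_esym_subst[OF iw])
      then show ?thesis using 1 by (simp add: c(2)[symmetric] d subst_mult)
    next
      case 2
      then have "- perm_subst (inv_into UNIV w) ?v = ?v"
        using perm_subst_inv(1)[OF w, of ?v] by (simp add: subst_uminus)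
      then have "perm_subst (inv_into UNIV w) ?v = - ?v"
        by (metis minus_minus)
      then have "perm_subst (inv_into UNIV w) g = - g"
        by (simp add: g_def subst_mult perm_subst_esym_subst[OF iw])
      moreover have "P0 (- g) = - P0 g"
        using weyl_z_additive[OF P0, of g "- g"] weyl_z_additive[OF P0, of 0 0]
        by (simp add: eq_neg_iff_add_eq_0 add.commute)
      ultimately show ?thesis using 2 by (simp add: c(2)[symmetric] d subst_mult subst_uminus)
    qed
  qed
  then have "P g = of_nat ?N * (Const (1 / of_nat ?N) * ?v)"
    by (simp add: P_def)
  then have "P g = Const (1 / of_nat ?N) * of_nat ?N * ?v"
    by (simp add: mult_ac)
  then have "P g = ?v"
    by (simp only: Const_inverse_card_perms mult_1)
  ultimately show ?thesis unfolding g_def by blast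
qed


section \<open>The annihilator\<close>

text \<open>Multiplication by a power of the discriminant makes the coefficient a polynomial
  \<open>a\<close>; the element of \<open>weyl_s\<close> matching an invariant operator from
  \<open>weyl_z_sym_to_vandermonde\<close> then sends \<open>a\<close> to \<open>1\<close>.
  Maximality and simplicity both rest on this.\<close>

lemma delta_act_to_one:
  assumes "x \<in> delta_module" "x \<noteq> 0"
  shows "\<exists>Q\<in>carrier weyl_s. delta_act Q x = 1"
proof -
  obtain a m where x: "x = to_fract a / to_fract discr ^ m"
    using assms(1) by (auto simp: delta_module_def)
  then have "a \<noteq> 0" using assms(2) by auto
  then obtain P where P: "P \<in> weyl_z_sym" "P (esym_subst a * vandermonde) = vandermonde"
    using weyl_z_sym_to_vandermonde by blast
  obtain Q T where Q: "lifted Q T" "\<forall>f. T (to_fract f) = to_fract (P f)"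
    using weyl_z_sym_lift[OF P(1)] by blast
  have "esym_fsubst (delta_act Q (to_fract a)) * to_fract vandermonde =
      T (to_fract (esym_subst a * vandermonde))"
    using Q(1) by (simp add: lifted_def flip: esym_fsubst_to_fract)
  also have "\<dots> = to_fract vandermonde"
    by (simp only: Q(2) P(2))
  finally have "esym_fsubst (delta_act Q (to_fract a)) = esym_fsubst 1"
    by (simp add: vandermonde_nonzero esym_fsubst_1)
  then have a: "delta_act Q (to_fract a) = 1"
    by (simp add: esym_fsubst_inject)
  have Qc: "Q \<in> carrier weyl_s" using Q(1) by (simp add: lifted_def)
  have "to_fract (discr ^ m) * x = to_fract a"
    using discr_nonzero[where 'n = 'a] by (simp add: x to_fract_power)
  then have "delta_act (Q \<circ> (*) (to_fract (discr ^ m))) x = 1"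
    by (simp only: delta_act_simps(5)[OF Qc weyl_s_mult] delta_act_mult a o_apply)
  then show ?thesis
    using weyl_s_closed(5)[OF Qc weyl_s_mult] by blast
qed

lemma delta_act_diff:
  assumes "S \<in> carrier weyl_s" "T \<in> carrier weyl_s"
  shows "(\<lambda>f. S f - T f) \<in> carrier weyl_s"
    "delta_act (\<lambda>f. S f - T f) = (\<lambda>f. delta_act S f - delta_act T f)"
proof -
  have neg: "(*) (to_fract (- 1)) \<circ> T \<in> carrier weyl_s"
    by (intro weyl_s_closed weyl_s_mult assms)
  have eq: "(\<lambda>f. S f - T f) = (\<lambda>f. S f + ((*) (to_fract (- 1)) \<circ> T) f)"
    by simp
  show "(\<lambda>f. S f - T f) \<in> carrier weyl_s"
    unfolding eq by (intro weyl_s_closed(6) assms neg)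
  show "delta_act (\<lambda>f. S f - T f) = (\<lambda>f. delta_act S f - delta_act T f)"
    unfolding eq delta_act_simps(6)[OF assms(1) neg] delta_act_simps(5)[OF weyl_s_mult assms(2)]
      delta_act_mult by simp
qed

text \<open>In each direction some \<open>discr ^ N\<close> times \<open>Q\<close> shares a lift
  with an invariant operator \<open>P\<close>. Evaluating that lift at the Vandermonde polynomial
  shows that \<open>P\<close> kills it exactly when \<open>Q\<close> kills the generator, since the
  discriminant is nonzero.\<close>

lemma ann_delta_eq:
  "(ann_delta :: ('n::{finite,linorder} ratfun \<Rightarrow> 'n ratfun) set) =
    localize (weyl_embed ` ann_sym) \<inter> carrier weyl_s"
proof (intro equalityI subsetI IntI)
  fix Q :: "'n ratfun \<Rightarrow> 'n ratfun" assume "Q \<in> ann_delta"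
  then have Q: "Q \<in> carrier weyl_s" "delta_act Q 1 = 0" by (auto simp: ann_delta_def)
  show "Q \<in> carrier weyl_s" by fact
  obtain N P T where P: "P \<in> weyl_z_sym" and T: "lifted ((*) (to_fract (discr ^ N)) \<circ> Q) T"
      "\<forall>f. T (to_fract f) = to_fract (P f)"
    using weyl_s_clear_denominators[OF Q(1)] by blast
  have "to_fract (P vandermonde) = T (esym_fsubst 1 * to_fract vandermonde)"
    by (simp add: T(2) esym_fsubst_1)
  also have "\<dots> = esym_fsubst (delta_act ((*) (to_fract (discr ^ N)) \<circ> Q) 1) * to_fract vandermonde"
    using T(1) by (simp only: lifted_def)
  also have "\<dots> = 0"
    by (simp add: delta_act_simps(5)[OF weyl_s_mult Q(1)] delta_act_mult Q(2) esym_fsubst_0)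
  finally have "P \<in> ann_sym"
    using P by (simp add: ann_sym_def)
  moreover have "Q = (\<lambda>f. weyl_embed P f / to_fract discr ^ N)"
    using discr_nonzero[where 'n = 'n] by (simp add: weyl_embed_lifted[OF T] to_fract_power)
  ultimately show "Q \<in> localize (weyl_embed ` ann_sym)"
    unfolding localize_def by blast
next
  fix Q :: "'n ratfun \<Rightarrow> 'n ratfun"
  assume *: "Q \<in> localize (weyl_embed ` ann_sym) \<inter> carrier weyl_s"
  then have Qc: "Q \<in> carrier weyl_s" by simp
  from * obtain P N where P_ann: "P \<in> ann_sym" and Q: "Q = (\<lambda>f. weyl_embed P f / to_fract discr ^ N)"
    by (auto simp: localize_def)
  from P_ann have P: "P \<in> weyl_z_sym" "P vandermonde = 0" by (auto simp: ann_sym_def)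
  obtain R T where T: "lifted R T" "\<forall>f. T (to_fract f) = to_fract (P f)"
    using weyl_z_sym_lift[OF P(1)] by blast
  have "esym_fsubst (delta_act R 1) * to_fract vandermonde = T (esym_fsubst 1 * to_fract vandermonde)"
    using T(1) by (simp only: lifted_def)
  also have "\<dots> = 0"
    by (simp add: T(2) esym_fsubst_1 P(2))
  finally have "delta_act R 1 = 0"
    by (simp add: vandermonde_nonzero esym_fsubst_eq_0_iff)
  moreover have "R = (*) (to_fract (discr ^ N)) \<circ> Q"
    using discr_nonzero[where 'n = 'n] by (auto simp: Q weyl_embed_lifted[OF T] to_fract_power)
  ultimately have "to_fract (discr ^ N) * delta_act Q 1 = 0"
    by (simp add: delta_act_simps(5)[OF weyl_s_mult Qc] delta_act_mult)
  then show "Q \<in> ann_delta"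
    using Qc discr_nonzero[where 'n = 'n] by (simp add: ann_delta_def)
qed

section \<open>Maximality and simplicity\<close>

lemma one_in_delta_module: "1 \<in> delta_module"
proof -
  have "1 = to_fract 1 / to_fract (discr :: 'a mpoly) ^ 0" by simp
  then show ?thesis unfolding delta_module_def by blast
qed

lemma delta_submodule_subset: "delta_submodule \<subseteq> delta_module"
  using left_submodule_delta_module one_in_delta_module
  by (auto simp: delta_submodule_def left_submodule_def)

lemma weyl_s_zero: "(\<lambda>_. 0) \<in> carrier weyl_s" "delta_act (\<lambda>_. 0) = (\<lambda>_. 0)"
  using delta_act_diff[OF weyl_s_closed(4) weyl_s_closed(4)] by simp_all

lemma left_ideal_ann_delta: "left_ideal ann_delta weyl_s"
proof -
  interpret W: ring "weyl_s :: ('a ratfun \<Rightarrow> 'a ratfun) ring" by (rule ring_weyl_s)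
  have "subgroup ann_delta (add_monoid (weyl_s :: ('a ratfun \<Rightarrow> 'a ratfun) ring))"
  proof (rule W.add.subgroupI)
    show "ann_delta \<noteq> ({} :: ('a ratfun \<Rightarrow> 'a ratfun) set)"
      by (auto simp: ann_delta_def weyl_s_zero intro!: exI[of _ "\<lambda>_. 0"])
  next
    fix Q :: "'a ratfun \<Rightarrow> 'a ratfun" assume Q: "Q \<in> ann_delta"
    then have Qc: "Q \<in> carrier weyl_s" by (simp add: ann_delta_def)
    have "\<ominus>\<^bsub>weyl_s\<^esub> Q = (\<lambda>f. 0 - Q f)"
      using Qc delta_act_diff(1)[OF weyl_s_zero(1) Qc] by (intro W.minus_equality) simp_all
    then show "\<ominus>\<^bsub>weyl_s\<^esub> Q \<in> ann_delta"
      using Q delta_act_diff[OF weyl_s_zero(1) Qc] by (simp add: ann_delta_def weyl_s_zero)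
  qed (auto simp: ann_delta_def weyl_s_closed delta_act_simps)
  moreover have "S \<circ> Q \<in> ann_delta" if "S \<in> carrier weyl_s" "Q \<in> ann_delta"
    for S Q :: "'a ratfun \<Rightarrow> 'a ratfun"
    using that by (simp add: ann_delta_def weyl_s_closed delta_act_simps delta_act_at_0)
  ultimately show ?thesis
    by (simp add: left_ideal_def additive_subgroup_def)
qed

lemma maximal_left_ideal_ann_delta: "maximal_left_ideal ann_delta weyl_s"
proof -
  have "L = carrier weyl_s"
    if L: "left_ideal L weyl_s" and sub: "ann_delta \<subseteq> L" and ne: "L \<noteq> ann_delta"
    for L :: "('a ratfun \<Rightarrow> 'a ratfun) set"
  proof -
    interpret L: additive_subgroup L weyl_s using L by (simp add: left_ideal_def)
    have mult: "S \<circ> Q \<in> L" if "S \<in> carrier weyl_s" "Q \<in> L" for S Q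
      using L that by (simp add: left_ideal_def)
    obtain Q where Q: "Q \<in> L" "Q \<notin> ann_delta" using sub ne by blast
    then have Qc: "Q \<in> carrier weyl_s" using L.a_subset by blast
    have "delta_act Q 1 \<in> delta_module" "delta_act Q 1 \<noteq> 0"
      using Q(2) Qc delta_submodule_subset by (auto simp: ann_delta_def delta_submodule_def)
    then obtain S where S: "S \<in> carrier weyl_s" "delta_act S (delta_act Q 1) = 1"
      using delta_act_to_one by blast
    have SQ: "S \<circ> Q \<in> carrier weyl_s" using S(1) Qc by (rule weyl_s_closed)
    \<comment> \<open>Since \<open>S \<circ> Q\<close> fixes \<open>1\<close>, it differs from the
      identity by an annihilating operator; this forces the identity into \<open>L\<close>.\<close>
    have "(\<lambda>f. id f - (S \<circ> Q) f) \<in> ann_delta"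
      using delta_act_diff[OF weyl_s_closed(4) SQ] S Qc by (simp add: ann_delta_def delta_act_simps)
    then have "(\<lambda>f. id f - (S \<circ> Q) f) \<oplus>\<^bsub>weyl_s\<^esub> (S \<circ> Q) \<in> L"
      using sub mult[OF S(1) Q(1)] by (intro L.a_closed) auto
    also have "(\<lambda>f. id f - (S \<circ> Q) f) \<oplus>\<^bsub>weyl_s\<^esub> (S \<circ> Q) = id"
      by auto
    finally have id: "id \<in> L" .
    have "S \<in> L" if "S \<in> carrier weyl_s" for S
      using mult[OF that id] by simp
    then show ?thesis using L.a_subset by blast
  qed
  moreover have "id \<in> carrier (weyl_s :: ('a ratfun \<Rightarrow> 'a ratfun) ring)" "id \<notin> (ann_delta :: ('a ratfun \<Rightarrow> 'a ratfun) set)"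
    by (simp_all add: weyl_s_closed ann_delta_def delta_act_simps)
  ultimately show ?thesis
    unfolding maximal_left_ideal_def using left_ideal_ann_delta by blast
qed

text \<open>By \<open>delta_act_to_one\<close> a nonzero submodule contains the generator
  \<open>1\<close>, hence everything generated by it.\<close>

lemma simple_delta_submodule: "simple_left_submodule weyl_s delta_act delta_submodule"
  unfolding simple_left_submodule_def
proof (intro conjI allI impI)
  have one: "1 \<in> (delta_submodule :: 'a ratfun set)"
    using weyl_s_closed(4) by (auto simp: delta_submodule_def delta_act_simps intro!: exI[of _ id])
  then show "delta_submodule \<noteq> ({0} :: 'a ratfun set)" by (metis singletonD zero_neq_one)
  show "left_submodule weyl_s delta_act (delta_submodule :: 'a ratfun set)"
    unfolding left_submodule_def
  proof (intro conjI ballI)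
    show "0 \<in> (delta_submodule :: 'a ratfun set)"
      unfolding delta_submodule_def by (intro CollectI exI[of _ "\<lambda>_. 0"]) (simp add: weyl_s_zero)
  next
    fix x y :: "'a ratfun" assume "x \<in> delta_submodule" "y \<in> delta_submodule"
    then obtain S T where ST: "S \<in> carrier weyl_s" "T \<in> carrier weyl_s" "x = delta_act S 1" "y = delta_act T 1"
      by (auto simp: delta_submodule_def)
    show "x - y \<in> delta_submodule"
      unfolding delta_submodule_def using ST delta_act_diff[OF ST(1,2)]
      by (intro CollectI exI[of _ "\<lambda>f. S f - T f"]) simp
  next
    fix S :: "'a ratfun \<Rightarrow> 'a ratfun" and x :: "'a ratfun" assume S: "S \<in> carrier weyl_s" and "x \<in> delta_submodule"
    then obtain T where T: "T \<in> carrier weyl_s" "x = delta_act T 1"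
      by (auto simp: delta_submodule_def)
    show "delta_act S x \<in> delta_submodule"
      unfolding delta_submodule_def using S T
      by (intro CollectI exI[of _ "S \<circ> T"]) (simp add: delta_act_simps weyl_s_closed)
  qed
  fix N :: "'a ratfun set"
  assume N: "left_submodule weyl_s delta_act N" "N \<subseteq> delta_submodule"
  show "N = {0} \<or> N = delta_submodule"
  proof (rule disjCI)
    assume "N \<noteq> delta_submodule"
    show "N = {0}"
    proof (rule ccontr)
      assume "N \<noteq> {0}"
      then obtain x where x: "x \<in> N" "x \<noteq> 0" using N(1) by (auto simp: left_submodule_def)
      then have "x \<in> delta_module" using N(2) delta_submodule_subset by blast
      then obtain Q where "Q \<in> carrier weyl_s" "delta_act Q x = 1"
        using delta_act_to_one x(2) by blast
      then have "1 \<in> N" using N(1) x(1) by (metis left_submodule_def)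
      then have "delta_submodule \<subseteq> N"
        using N(1) by (auto simp: left_submodule_def delta_submodule_def)
      with N(2) \<open>N \<noteq> delta_submodule\<close> show False by blast
    qed
  qed
qed

theorem theorem2p3p5:
  shows "(ann_delta :: ('n::{finite,linorder} ratfun \<Rightarrow> 'n ratfun) set) =
      localize (weyl_embed ` ann_sym) \<inter> carrier weyl_s \<and>
    maximal_left_ideal (ann_delta :: ('n ratfun \<Rightarrow> 'n ratfun) set) weyl_s \<and>
    (delta_submodule :: 'n ratfun set) \<subseteq> delta_module \<and>
    simple_left_submodule weyl_s delta_act (delta_submodule :: 'n ratfun set)"
  using ann_delta_eq maximal_left_ideal_ann_delta delta_submodule_subset simple_delta_submodule
  by blast

end
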